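(* Let $\mathcal{H}$ be a real Hilbert space with norm $\|\cdot\|$, let $(C,\mathcal{D}(C))$ be an (at most) single-valued, linear, self-adjoint and maximally dissipative operator on $\mathcal{H}$, and let $\kappa\in\mathbb{R}$. Let $\mathcal{E}:\mathcal{H}\to(-\infty,+\infty]$ be the lower semi-continuous regularization of $$\mathcal{E}_0(\rho)=\begin{cases}-\frac12\langle C\rho,\rho\rangle+\frac{\kappa}{2}\|\rho\|^2&\text{if }\rho\in\mathcal{D}(C),\\ +\infty&\text{otherwise.}\end{cases}$$ Put $E=\mathcal{H}$ and $d(\rho,\pi)=\|\rho-\pi\|$. Then for every $\lambda>0$, all bounded and uniformly continuous $h^\dagger,h^\ddagger:E\to\mathbb{R}$, every viscosity subsolution $u:E\to\mathbb{R}$ to $f-\lambda H_\dagger f=h^\dagger$ and every viscosity supersolution $v:E\to\mathbb{R}$ to $f-\lambda H_\ddagger f=h^\ddagger$, $$\sup_{\pi\in E}\big(u(\pi)-v(\pi)\big)\le\sup_{\pi\in E}\big(h^\dagger(\pi)-h^\ddagger(\pi)\big).$$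
   Context: An operator $C\subseteq\mathcal{H}\times\mathcal{H}$ is dissipative if $\langle\xi_1-\xi_2,\rho_1-\rho_2\rangle\le0$ for all $(\rho_1,\xi_1),(\rho_2,\xi_2)\in C$; it is maximally dissipative if any dissipative extension of $C$ equals $C$. Domain: $\mathcal{D}(\mathcal{E})=\{\pi\in E:\mathcal{E}(\pi)<+\infty\}$. EVI gradient flow: a solution of $EVI_\kappa$ is a continuous curve $\gamma:[0,+\infty)\to E$ with $\gamma((0,+\infty))\subseteq\mathcal{D}(\mathcal{E})$ such that for all $\rho\in\mathcal{D}(\mathcal{E})$, $t\in[0,+\infty)$, $$\frac12\frac{d^+}{dt}d^2(\gamma(t),\rho)\le\mathcal{E}(\rho)-\mathcal{E}(\gamma(t))-\frac{\kappa}{2}d^2(\gamma(t),\rho),$$ where $\frac{d^+}{dt}$ is the upper right time derivative. An $EVI_\kappa$ gradient flow of $\mathcal{E}$ on $E$ is a family of continuous maps $S(t):E\to E$, $t\ge0$, such that for every $\pi\in E$: $S[\pi](0)=\pi$, $S[\pi](t+s)=S[S[\pi](t)](s)$ for $s,t\ge0$, and $t\mapsto S[\pi](t)$ is a solution of $EVI_\kappa$. One writes $\pi(t):=S[\pi](t)$. In the setting of the claim this flow exists and is unique (Brezis–Pazy theorem for $\kappa$-convex lower semi-continuous functionals on Hilbert spaces), and it is the one used below. Tataru distance: with $\hat\kappa=\min(0,\kappa)$, $d_T(\pi,\rho)=\inf_{t\ge0}\{t+e^{\hat\kappa t}d(\pi,\rho(t))\}$ for $\pi,\rho\in E$. Hamiltonians: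 $H_\dagger$ is the set of all pairs $(f^\dagger,g^\dagger)$ of functions on $E$, indexed by $a,b>0$, $c\in\mathbb{R}$, $\mu,\rho\in E$ with $\mathcal{E}(\rho)<\infty$, of the form $$f^\dagger(\pi)=\tfrac12 a\,d^2(\pi,\rho)+b\,d_T(\pi,\mu)+c,$$ $$g^\dagger(\pi)=a[\mathcal{E}(\rho)-\mathcal{E}(\pi)]-a\tfrac{\kappa}{2}d^2(\pi,\rho)+b+\tfrac12a^2d^2(\pi,\rho)+ab\,d(\pi,\rho)+\tfrac12b^2.$$ $H_\ddagger$ is the set of all pairs $(f^\ddagger,g^\ddagger)$, indexed by $a,b>0$, $c\in\mathbb{R}$, $\pi,\gamma\in E$ with $\mathcal{E}(\gamma)<\infty$, of the form $$f^\ddagger(\mu)=-\tfrac12a\,d^2(\gamma,\mu)-b\,d_T(\mu,\pi)+c,$$ $$g^\ddagger(\mu)=a[\mathcal{E}(\mu)-\mathcal{E}(\gamma)]+a\tfrac{\kappa}{2}d^2(\gamma,\mu)-b+\tfrac12a^2d^2(\gamma,\mu)-ab\,d(\gamma,\mu)-\tfrac12b^2.$$ Viscosity solutions: $u$ is a (viscosity) subsolution of $f-\lambda H_\dagger f=h^\dagger$ if $u$ is bounded, upper semi-continuous and for all $(f,g)\in H_\dagger$ there is a sequence $(\pi_n)$ in $E$ with $\lim_n (u(\pi_n)-f(\pi_n))=\sup_\pi (u(\pi)-f(\pi))$ and $\limsup_n (u(\pi_n)-\lambda g(\pi_n)-h^\dagger(\pi_n))\le0$. $v$ is a (viscosity)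 supersolution of $f-\lambda H_\ddagger f=h^\ddagger$ if $v$ is bounded, lower semi-continuous and for all $(f,g)\in H_\ddagger$ there is a sequence $(\pi_n)$ in $E$ with $\lim_n (v(\pi_n)-f(\pi_n))=\inf_\pi (v(\pi)-f(\pi))$ and $\liminf_n (v(\pi_n)-\lambda g(\pi_n)-h^\ddagger(\pi_n))\ge0$. *)

theory Defs
  imports "HOL-Analysis.Analysis"
begin

section \<open>Operators on a Hilbert space, as subsets of the product\<close>

definition dissipative :: "('a::real_inner \<times> 'a) set \<Rightarrow> bool" where
  "dissipative C \<longleftrightarrow>
     (\<forall>(\<rho>\<^sub>1, \<xi>\<^sub>1) \<in> C. \<forall>(\<rho>\<^sub>2, \<xi>\<^sub>2) \<in> C. (\<xi>\<^sub>1 - \<xi>\<^sub>2) \<bullet> (\<rho>\<^sub>1 - \<rho>\<^sub>2) \<le> 0)"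

definition maximally_dissipative :: "('a::real_inner \<times> 'a) set \<Rightarrow> bool" where
  "maximally_dissipative C \<longleftrightarrow>
     dissipative C \<and> (\<forall>D. C \<subseteq> D \<longrightarrow> dissipative D \<longrightarrow> D = C)"

definition adjoint_operator :: "('a::real_inner \<times> 'a) set \<Rightarrow> ('a \<times> 'a) set" where
  "adjoint_operator C = {(y, z). \<forall>(x, w) \<in> C. w \<bullet> y = x \<bullet> z}"

text \<open>The adjoint relation is single-valued precisely when the domain of \<open>C\<close> is dense. Hence
  a single-valued \<open>C\<close> that equals its adjoint is automatically densely defined, and for such \<open>C\<close>
  the following is the usual self-adjointness, including equality of the domains.\<close>

definition self_adjoint_operator :: "('a::real_inner \<times> 'a) set \<Rightarrow> bool" where
  "self_adjoint_operator C \<longleftrightarrow> adjoint_operator C = C"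

definition quadratic_energy :: "('a::real_inner \<times> 'a) set \<Rightarrow> real \<Rightarrow> 'a \<Rightarrow> ereal" where
  "quadratic_energy C \<kappa> \<rho> =
     (if \<rho> \<in> Domain C
      then ereal (- (1/2) * ((THE \<xi>. (\<rho>, \<xi>) \<in> C) \<bullet> \<rho>) + \<kappa>/2 * (norm \<rho>)\<^sup>2)
      else \<infinity>)"

section \<open>Semicontinuity\<close>

definition lower_semicontinuous :: "('a::topological_space \<Rightarrow> 'b::order) \<Rightarrow> bool" where
  "lower_semicontinuous f \<longleftrightarrow> (\<forall>x. \<forall>c < f x. \<forall>\<^sub>F y in nhds x. c < f y)"

definition upper_semicontinuous :: "('a::topological_space \<Rightarrow> 'b::order) \<Rightarrow> bool" where
  "upper_semicontinuous f \<longleftrightarrow> (\<forall>x. \<forall>c > f x. \<forall>\<^sub>F y in nhds x. f y < c)"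

definition lsc_regularization :: "('a::topological_space \<Rightarrow> ereal) \<Rightarrow> 'a \<Rightarrow> ereal" where
  "lsc_regularization f = Sup {g. lower_semicontinuous g \<and> g \<le> f}"

section \<open>EVI gradient flows\<close>

text \<open>The difference quotients are real, but their upper limit may be infinite. For instance, along
  a gradient flow started outside the domain of the energy the derivative at time 0 of the squared
  distance to a point of the domain is \<open>-\<infinity>\<close>.\<close>

definition upper_right_deriv :: "(real \<Rightarrow> real) \<Rightarrow> real \<Rightarrow> ereal" where
  "upper_right_deriv f t = Limsup (at_right t) (\<lambda>s. ereal ((f s - f t) / (s - t)))"

definition evi_solution ::
    "real \<Rightarrow> ('a::metric_space \<Rightarrow> ereal) \<Rightarrow> (real \<Rightarrow> 'a) \<Rightarrow> bool" where
  "evi_solution \<kappa> \<E> \<gamma> \<longleftrightarrow>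
     continuous_on {0..} \<gamma> \<and>
     (\<forall>t>0. \<E> (\<gamma> t) < \<infinity>) \<and>
     (\<forall>\<rho>. \<E> \<rho> < \<infinity> \<longrightarrow>
        (\<forall>t\<ge>0. ereal (1/2) * upper_right_deriv (\<lambda>s. (dist (\<gamma> s) \<rho>)\<^sup>2) t
                \<le> \<E> \<rho> - \<E> (\<gamma> t) - ereal (\<kappa>/2 * (dist (\<gamma> t) \<rho>)\<^sup>2)))"

definition evi_gradient_flow ::
    "real \<Rightarrow> ('a::metric_space \<Rightarrow> ereal) \<Rightarrow> (real \<Rightarrow> 'a \<Rightarrow> 'a) \<Rightarrow> bool" where
  "evi_gradient_flow \<kappa> \<E> S \<longleftrightarrow>
     (\<forall>t\<ge>0. continuous_on UNIV (S t)) \<and>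
     (\<forall>\<pi>. S 0 \<pi> = \<pi> \<and>
          (\<forall>t\<ge>0. \<forall>s\<ge>0. S (t + s) \<pi> = S s (S t \<pi>)) \<and>
          evi_solution \<kappa> \<E> (\<lambda>t. S t \<pi>))"

text \<open>A flow is unique on nonnegative times only (its values at negative times are
  unconstrained), hence \<open>SOME\<close> instead of \<open>THE\<close>; only nonnegative times are used below.\<close>

definition the_evi_flow :: "real \<Rightarrow> ('a::metric_space \<Rightarrow> ereal) \<Rightarrow> real \<Rightarrow> 'a \<Rightarrow> 'a" where
  "the_evi_flow \<kappa> \<E> = (SOME S. evi_gradient_flow \<kappa> \<E> S)"

definition tataru_dist ::
    "real \<Rightarrow> ('a::metric_space \<Rightarrow> ereal) \<Rightarrow> 'a \<Rightarrow> 'a \<Rightarrow> real" where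
  "tataru_dist \<kappa> \<E> \<pi> \<rho> =
     (INF t\<in>{0..}. t + exp (min 0 \<kappa> * t) * dist \<pi> (the_evi_flow \<kappa> \<E> t \<rho>))"

section \<open>Upper and lower Hamiltonians\<close>

text \<open>The second components are extended-real-valued: the upper one takes the value \<open>-\<infinity>\<close> and the
  lower one the value \<open>\<infinity>\<close> outside the domain of the energy. The energy is meant to take values
  in \<open>(-\<infinity>, \<infinity>]\<close>, so that no difference \<open>\<infinity> - \<infinity>\<close> occurs.\<close>

definition H_dagger ::
    "real \<Rightarrow> ('a::metric_space \<Rightarrow> ereal) \<Rightarrow> (('a \<Rightarrow> real) \<times> ('a \<Rightarrow> ereal)) set" where
  "H_dagger \<kappa> \<E> =
     {(\<lambda>\<pi>. 1/2 * a * (dist \<pi> \<rho>)\<^sup>2 + b * tataru_dist \<kappa> \<E> \<pi> \<mu> + c,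
       \<lambda>\<pi>. ereal a * (\<E> \<rho> - \<E> \<pi>)
            + ereal (- a * (\<kappa>/2) * (dist \<pi> \<rho>)\<^sup>2 + b + 1/2 * a\<^sup>2 * (dist \<pi> \<rho>)\<^sup>2
                     + a * b * dist \<pi> \<rho> + 1/2 * b\<^sup>2))
      | a b c \<mu> \<rho>. a > 0 \<and> b > 0 \<and> \<E> \<rho> < \<infinity>}"

definition H_ddagger ::
    "real \<Rightarrow> ('a::metric_space \<Rightarrow> ereal) \<Rightarrow> (('a \<Rightarrow> real) \<times> ('a \<Rightarrow> ereal)) set" where
  "H_ddagger \<kappa> \<E> =
     {(\<lambda>\<mu>. - (1/2) * a * (dist \<gamma> \<mu>)\<^sup>2 - b * tataru_dist \<kappa> \<E> \<mu> \<pi> + c,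
       \<lambda>\<mu>. ereal a * (\<E> \<mu> - \<E> \<gamma>)
            + ereal (a * (\<kappa>/2) * (dist \<gamma> \<mu>)\<^sup>2 - b + 1/2 * a\<^sup>2 * (dist \<gamma> \<mu>)\<^sup>2
                     - a * b * dist \<gamma> \<mu> - 1/2 * b\<^sup>2))
      | a b c \<pi> \<gamma>. a > 0 \<and> b > 0 \<and> \<E> \<gamma> < \<infinity>}"

section \<open>Viscosity solutions\<close>

definition viscosity_subsolution ::
    "real \<Rightarrow> (('a::metric_space \<Rightarrow> real) \<times> ('a \<Rightarrow> ereal)) set \<Rightarrow> ('a \<Rightarrow> real) \<Rightarrow> ('a \<Rightarrow> real) \<Rightarrow> bool"
  where
  "viscosity_subsolution lam H h u \<longleftrightarrow>
     bounded (range u) \<and> upper_semicontinuous u \<and>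
     (\<forall>(f, g) \<in> H. \<exists>\<pi> :: nat \<Rightarrow> 'a.
        (\<lambda>n. ereal (u (\<pi> n) - f (\<pi> n))) \<longlonglongrightarrow> (SUP x. ereal (u x - f x)) \<and>
        limsup (\<lambda>n. ereal (u (\<pi> n)) - ereal lam * g (\<pi> n) - ereal (h (\<pi> n))) \<le> 0)"

definition viscosity_supersolution ::
    "real \<Rightarrow> (('a::metric_space \<Rightarrow> real) \<times> ('a \<Rightarrow> ereal)) set \<Rightarrow> ('a \<Rightarrow> real) \<Rightarrow> ('a \<Rightarrow> real) \<Rightarrow> bool"
  where
  "viscosity_supersolution lam H h v \<longleftrightarrow>
     bounded (range v) \<and> lower_semicontinuous v \<and>
     (\<forall>(f, g) \<in> H. \<exists>\<pi> :: nat \<Rightarrow> 'a.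
        (\<lambda>n. ereal (v (\<pi> n) - f (\<pi> n))) \<longlonglongrightarrow> (INF x. ereal (v x - f x)) \<and>
        liminf (\<lambda>n. ereal (v (\<pi> n)) - ereal lam * g (\<pi> n) - ereal (h (\<pi> n))) \<ge> 0)"

end

theory Submission
  imports Defs
begin

text \<open>Write the energy as \<open>\<E> x = q x + \<kappa>/2 * (norm x)\<^sup>2\<close>. Dissipativity makes \<open>q\<close> convex and
  nonnegative on the domain of \<open>\<E>\<close>, and self-adjointness makes that domain dense. The comparison
  principle follows from these properties.

  The coefficient \<open>b\<close> of the Tataru distance in the test functions is at our disposal. The Tataru
  distance is nonnegative and near-maximizers stay bounded uniformly in \<open>b\<close>, so letting \<open>b\<close> tend to 0
  leaves purely quadratic test functions centered at points of finite energy
  (\<open>subsolution_imp_quadratic_test\<close>, \<open>supersolution_imp_quadratic_test\<close>).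

  As a maximizer of the usual doubled functional may have infinite energy, the variables are quadrupled:
  one maximizes approximately
  \<open>u \<pi> - v \<mu> - \<beta>/2 * ((norm (\<pi> - \<rho>))\<^sup>2 + (norm (\<rho> - \<gamma>))\<^sup>2 + (norm (\<gamma> - \<mu>))\<^sup>2)\<close>
  with a penalty \<open>\<epsilon> * (q + (norm _)\<^sup>2 / 2)\<close> on \<open>\<rho>\<close> and \<open>\<gamma>\<close>. The viscosity inequality at \<open>\<pi>\<close> contains the
  term \<open>\<beta> * (q \<rho> - q \<pi>)\<close>. To bound it, \<open>\<rho>\<close> is moved by a small multiple of
  \<open>w = \<beta> *\<^sub>R (\<pi> - \<rho>) - \<beta> *\<^sub>R (\<rho> - \<gamma>)\<close>, that is, to a convex combination of \<open>\<rho>\<close>, \<open>\<pi>\<close> and \<open>\<gamma>\<close>. Convexity of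
  \<open>q\<close> and near-maximality give, up to small errors,
  \<open>\<beta> * (q \<rho> - q \<pi>) \<le> \<beta> * (q \<gamma> - q \<rho>) - (norm w)\<^sup>2 / \<epsilon> + \<rho> \<bullet> w\<close>
  (\<open>energy_slope_at_near_maximizer\<close>). The same holds with the roles exchanged, the energies of \<open>\<rho>\<close> and
  \<open>\<gamma>\<close> cancel in the sum, and the negative squares absorb, up to controlled quantities, every other term in which \<open>w\<close> or its
  counterpart occurs (\<open>hamiltonian_gap\<close>). What remains is controlled by the penalties, which are small
  for suitable \<open>\<beta>\<close> and \<open>\<epsilon>\<close> (\<open>doubling_parameters\<close>). The result is \<open>quadratic_test_comparison\<close>.\<close>

section \<open>Orthogonal vectors and density of the domain\<close>

text \<open>The vector is \<open>x - p\<close>, where \<open>p\<close> is the point of the closure of \<open>L\<close> that is closest to \<open>x\<close>.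
  A minimizing sequence is Cauchy by the parallelogram law.\<close>

lemma exists_nonzero_orthogonal:
  fixes L :: "'a::{real_inner, complete_space} set"
  assumes L: "subspace L" and x: "x \<notin> closure L"
  obtains z where "z \<noteq> 0" "\<And>y. y \<in> L \<Longrightarrow> y \<bullet> z = 0"
proof -
  have ne: "L \<noteq> {}" using subspace_0[OF L] by auto
  define d where "d = infdist x L"
  have d: "d \<ge> 0" "\<And>y. y \<in> L \<Longrightarrow> d \<le> dist x y"
    by (auto simp: d_def infdist_nonneg infdist_le)
  have "\<exists>y\<in>L. dist x y < d + 1 / Suc n" for n
  proof (rule ccontr)
    assume "\<not> ?thesis"
    hence "d + 1 / Suc n \<le> infdist x L"
      using ne unfolding infdist_def by (auto intro!: cINF_greatest simp: not_less)
    thus False by (simp add: d_def)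
  qed
  then obtain y where y: "\<And>n. y n \<in> L" "\<And>n. dist x (y n) < d + 1 / Suc n" by metis
  have ybound: "(norm (x - y n))\<^sup>2 \<le> d\<^sup>2 + (2 * d + 1) / Suc n" for n
  proof -
    have "(norm (x - y n))\<^sup>2 \<le> (d + 1 / Suc n)\<^sup>2"
      using y(2)[of n] by (intro power_mono) (auto simp: dist_norm)
    also have "\<dots> = d\<^sup>2 + 2 * d / Suc n + (1 / Suc n) * (1 / Suc n)"
      by (simp add: power2_eq_square algebra_simps)
    also have "(1 / real (Suc n)) * (1 / Suc n) \<le> 1 * (1 / Suc n)"
      by (intro mult_right_mono) auto
    finally show ?thesis by (simp add: add_divide_distrib)
  qed
  have close: "(norm (y m - y n))\<^sup>2 \<le> 2 * ((2 * d + 1) / Suc m) + 2 * ((2 * d + 1) / Suc n)" for m n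
  proof -
    have "(1/2) *\<^sub>R (y m + y n) \<in> L"
      by (intro subspace_scale[OF L] subspace_add[OF L] y)
    hence "d \<le> norm (x - (1/2) *\<^sub>R (y m + y n))" using d(2) by (simp add: dist_norm)
    hence "d\<^sup>2 \<le> (norm (x - (1/2) *\<^sub>R (y m + y n)))\<^sup>2" using d(1) by (intro power_mono)
    also have "4 * \<dots> = 2 * (norm (x - y m))\<^sup>2 + 2 * (norm (x - y n))\<^sup>2 - (norm (y m - y n))\<^sup>2"
      unfolding power2_norm_eq_inner by (simp add: inner_simps inner_commute algebra_simps)
    finally show ?thesis using ybound[of m] ybound[of n] by linarith
  qed
  have lim0: "(\<lambda>n. K / real (Suc n)) \<longlonglongrightarrow> 0" for K
    by (rule LIMSEQ_Suc[OF lim_const_over_n])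
  have "Cauchy y"
  proof (rule metric_CauchyI)
    fix e :: real assume e: "e > 0"
    have "\<forall>\<^sub>F n in sequentially. (2 * d + 1) / real (Suc n) < e\<^sup>2 / 4"
      using e by (intro order_tendstoD(2)[OF lim0]) auto
    then obtain N where N: "\<And>n. n \<ge> N \<Longrightarrow> (2 * d + 1) / real (Suc n) < e\<^sup>2 / 4"
      by (auto simp: eventually_sequentially)
    show "\<exists>M. \<forall>m\<ge>M. \<forall>n\<ge>M. dist (y m) (y n) < e"
    proof (intro exI allI impI)
      fix m n assume "m \<ge> N" "n \<ge> N"
      hence "(norm (y m - y n))\<^sup>2 < e\<^sup>2"
        using N[of m] N[of n] close[of m n] by linarith
      thus "dist (y m) (y n) < e" using e by (simp add: dist_norm power2_less_imp_less)
    qed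
  qed
  then obtain p where p: "y \<longlonglongrightarrow> p" by (auto simp: Cauchy_convergent_iff convergent_def)
  have pcl: "p \<in> closure L" using p y(1) by (auto simp: closure_sequential)
  define z where "z = x - p"
  have z0: "z \<noteq> 0" using pcl x by (auto simp: z_def)
  have "(\<lambda>n. dist x (y n)) \<longlonglongrightarrow> dist x p" by (intro tendsto_intros p)
  moreover have "(\<lambda>n. d + 1 / Suc n) \<longlonglongrightarrow> d + 0" by (intro tendsto_intros lim0)
  ultimately have zd: "norm z \<le> d"
    using LIMSEQ_le[of "\<lambda>n. dist x (y n)" "dist x p" "\<lambda>n. d + 1 / Suc n" "d + 0"] y(2)
    by (auto simp: z_def dist_norm intro: less_imp_le)
  have min: "norm z \<le> norm (z - v)" if "v \<in> L" for v
  proof -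
    have "(\<lambda>n. dist x (y n + v)) \<longlonglongrightarrow> dist x (p + v)" by (intro tendsto_intros p)
    hence "d \<le> dist x (p + v)"
      by (rule LIMSEQ_le_const) (auto intro!: d(2) subspace_add[OF L] y that)
    thus ?thesis using zd by (simp add: z_def dist_norm algebra_simps)
  qed
  have "v \<bullet> z = 0" if v: "v \<in> L" for v
  proof (cases "v = 0")
    case False
    define t where "t = (v \<bullet> z) / (v \<bullet> v)"
    have "(norm z)\<^sup>2 \<le> (norm (z - t *\<^sub>R v))\<^sup>2"
      by (intro power_mono min subspace_scale[OF L] v) auto
    also have "\<dots> = (norm z)\<^sup>2 - (v \<bullet> z)\<^sup>2 / (v \<bullet> v)"
      unfolding power2_norm_eq_inner using False
      by (simp add: inner_simps inner_commute t_def field_simps power2_eq_square)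
    finally have "(v \<bullet> z)\<^sup>2 / (v \<bullet> v) \<le> 0" by simp
    moreover have "v \<bullet> v > 0" using False by simp
    ultimately have "(v \<bullet> z)\<^sup>2 \<le> 0" by (simp add: pos_divide_le_eq)
    thus ?thesis by simp
  qed auto
  thus ?thesis using z0 that by blast
qed

text \<open>A vector \<open>z\<close> orthogonal to the domain makes \<open>(0, z)\<close> an element of the adjoint, hence of \<open>C\<close>;
  a single-valued linear relation contains no such pair with \<open>z \<noteq> 0\<close>.\<close>

lemma dense_Domain_self_adjoint:
  fixes C :: "('a::{real_inner, complete_space} \<times> 'a) set"
  assumes sv: "single_valued C" and sub: "subspace C" and sa: "self_adjoint_operator C"
  shows "closure (Domain C) = UNIV"
proof (rule ccontr)
  assume "closure (Domain C) \<noteq> UNIV"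
  then obtain x where x: "x \<notin> closure (Domain C)" by auto
  have "subspace (fst ` C)" by (rule linear_subspace_image[OF linear_fst sub])
  hence "subspace (Domain C)" by (simp add: Domain_fst)
  then obtain z where z: "z \<noteq> 0" "\<And>y. y \<in> Domain C \<Longrightarrow> y \<bullet> z = 0"
    using exists_nonzero_orthogonal[OF _ x] by blast
  have "(0, z) \<in> adjoint_operator C"
    using z(2) by (auto simp: adjoint_operator_def)
  hence "(0, z) \<in> C" using sa by (simp add: self_adjoint_operator_def)
  moreover have "(0, 0) \<in> C" using subspace_0[OF sub] by (simp add: zero_prod_def)
  ultimately show False using sv z(1) by (auto dest: single_valuedD)
qed

section \<open>Lower semicontinuous regularization\<close>

lemma lsc_regularization_le: "lsc_regularization f x \<le> f x"
  unfolding lsc_regularization_def by (auto simp: le_fun_def intro!: SUP_least)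

lemma lsc_regularization_greatest:
  "lower_semicontinuous g \<Longrightarrow> g \<le> f \<Longrightarrow> g x \<le> lsc_regularization f x"
  unfolding lsc_regularization_def by (auto intro!: SUP_upper2)

lemma lsc_lsc_regularization: "lower_semicontinuous (lsc_regularization f)"
  unfolding lower_semicontinuous_def
proof (intro allI impI)
  fix x c assume "c < lsc_regularization f x"
  then obtain g where g: "lower_semicontinuous g" "g \<le> f" "c < g x"
    unfolding lsc_regularization_def by (auto simp: less_SUP_iff)
  hence "\<forall>\<^sub>F y in nhds x. c < g y" by (auto simp: lower_semicontinuous_def)
  thus "\<forall>\<^sub>F y in nhds x. c < lsc_regularization f y"
    by eventually_elim (use lsc_regularization_greatest[OF g(1,2)] in \<open>auto intro: less_le_trans\<close>)
qed

text \<open>If \<open>f\<close> were at least \<open>c\<close> on a ball around \<open>x\<close>, the function equal to a value slightly below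
  \<open>c\<close> on the ball and to \<open>-\<infinity>\<close> elsewhere would be a lower semicontinuous minorant that exceeds the
  regularization at \<open>x\<close>.\<close>

lemma lsc_regularization_approx:
  fixes f :: "'a::metric_space \<Rightarrow> ereal"
  assumes "lsc_regularization f x < c"
  obtains y where "\<And>n. f (y n) < c" "y \<longlonglongrightarrow> x"
proof -
  obtain c' where c': "lsc_regularization f x < c'" "c' < c" using dense[OF assms] by blast
  have "\<exists>y. dist y x < 1 / Suc n \<and> f y < c" for n
  proof (rule ccontr)
    assume H: "\<not> ?thesis"
    define g where "g y = (if dist y x < 1 / Suc n then c' else (- \<infinity>))" for y
    have "lower_semicontinuous g"
      unfolding lower_semicontinuous_def
    proof (intro allI impI)
      fix y b assume "b < g y"
      hence b: "b < c'" "y \<in> ball x (1 / Suc n)"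
        by (auto simp: g_def dist_commute split: if_splits)
      have "\<forall>\<^sub>F y' in nhds y. y' \<in> ball x (1 / Suc n)"
        by (rule eventually_nhds_in_open) (use b in auto)
      thus "\<forall>\<^sub>F y' in nhds y. b < g y'"
        by eventually_elim (use b in \<open>auto simp: g_def dist_commute\<close>)
    qed
    moreover have "g \<le> f"
    proof (rule le_funI)
      fix y show "g y \<le> f y"
      proof (cases "dist y x < 1 / Suc n")
        case True
        hence "c \<le> f y" using H by (meson not_le)
        thus ?thesis using c'(2) True by (simp add: g_def order_trans[OF less_imp_le])
      qed (simp add: g_def)
    qed
    ultimately have "g x \<le> lsc_regularization f x" by (rule lsc_regularization_greatest)
    thus False using c' by (simp add: g_def)
  qed
  then obtain y where y: "\<And>n. dist (y n) x < 1 / Suc n" "\<And>n. f (y n) < c" by metis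
  have "(\<lambda>n. dist (y n) x) \<longlonglongrightarrow> 0"
    by (rule tendsto_sandwich[OF _ _ tendsto_const LIMSEQ_Suc[OF lim_const_over_n[of 1]]])
      (use y in \<open>auto intro!: always_eventually less_imp_le\<close>)
  hence "y \<longlonglongrightarrow> x" by (subst tendsto_dist_iff)
  thus ?thesis using that y by blast
qed

lemma lower_semicontinuous_seq_le:
  fixes f :: "'a::metric_space \<Rightarrow> ereal"
  assumes "lower_semicontinuous f" "y \<longlonglongrightarrow> x" "r \<longlonglongrightarrow> l" "\<And>n. f (y n) \<le> ereal (r n)"
  shows "f x \<le> ereal l"
proof (rule ccontr)
  assume "\<not> ?thesis"
  then obtain c where c: "ereal l < ereal c" "ereal c < f x"
    using ereal_dense2[of "ereal l" "f x"] by (metis not_le)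
  have "\<forall>\<^sub>F n in sequentially. ereal c < f (y n)"
    by (rule eventually_compose_filterlim[OF _ assms(2)]) (use assms(1) c(2) in \<open>auto simp: lower_semicontinuous_def\<close>)
  moreover have "\<forall>\<^sub>F n in sequentially. r n < c" using assms(3) c(1) by (intro order_tendstoD) auto
  ultimately have "\<forall>\<^sub>F n in sequentially. False"
    by eventually_elim (metis assms(4) ereal_less(1) less_ereal.simps(1) less_le_trans not_less_iff_gr_or_eq)
  thus False by simp
qed

section \<open>The energy of a linear dissipative operator\<close>

lemma quadratic_energy_eq:
  assumes "single_valued C" "(x, \<xi>) \<in> C"
  shows "quadratic_energy C \<kappa> x = ereal (- (1/2) * (\<xi> \<bullet> x) + \<kappa>/2 * (norm x)\<^sup>2)"
proof -
  have "(THE \<xi>. (x, \<xi>) \<in> C) = \<xi>" using assms by (auto dest: single_valuedD)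
  thus ?thesis using assms by (auto simp: quadratic_energy_def)
qed

locale dissipative_quadratic_energy =
  fixes C :: "('a::real_inner \<times> 'a) set" and \<kappa> :: real and \<E> :: "'a \<Rightarrow> ereal"
  assumes single_valued: "single_valued C" and subspace: "subspace C"
    and dissipative: "dissipative C"
    and \<E>_def: "\<E> = lsc_regularization (quadratic_energy C \<kappa>)"
begin

lemma inner_nonpos: "(x, \<xi>) \<in> C \<Longrightarrow> \<xi> \<bullet> x \<le> 0"
  using dissipative subspace_0[OF subspace] unfolding dissipative_def zero_prod_def by fastforce

lemma energy_lower_bound: "ereal (\<kappa>/2 * (norm x)\<^sup>2) \<le> \<E> x"
  unfolding \<E>_def
proof (rule lsc_regularization_greatest)
  show "lower_semicontinuous (\<lambda>x::'a. ereal (\<kappa>/2 * (norm x)\<^sup>2))"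
    unfolding lower_semicontinuous_def
  proof (intro allI impI)
    fix x :: 'a and c assume "c < ereal (\<kappa>/2 * (norm x)\<^sup>2)"
    moreover have "((\<lambda>x. ereal (\<kappa>/2 * (norm x)\<^sup>2)) \<longlongrightarrow> ereal (\<kappa>/2 * (norm x)\<^sup>2)) (nhds x)"
      by (intro tendsto_ereal tendsto_intros filterlim_ident)
    ultimately show "\<forall>\<^sub>F y in nhds x. c < ereal (\<kappa>/2 * (norm y)\<^sup>2)" by (rule order_tendstoD(1)[rotated])
  qed
  show "(\<lambda>x. ereal (\<kappa>/2 * (norm x)\<^sup>2)) \<le> quadratic_energy C \<kappa>"
  proof (rule le_funI)
    fix x show "ereal (\<kappa>/2 * (norm x)\<^sup>2) \<le> quadratic_energy C \<kappa> x"
    proof (cases "x \<in> Domain C")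
      case True
      then obtain \<xi> where "(x, \<xi>) \<in> C" by auto
      thus ?thesis using inner_nonpos by (simp add: quadratic_energy_eq[OF single_valued])
    qed (simp add: quadratic_energy_def)
  qed
qed

text \<open>Removing the curvature term makes the energy convex and nonnegative on its domain. Only
  the values on that domain are meaningful, since \<open>real_of_ereal\<close> sends infinite energy to 0.\<close>

definition convex_part :: "'a \<Rightarrow> real" where
  "convex_part x = real_of_ereal (\<E> x) - \<kappa>/2 * (norm x)\<^sup>2"

lemma energy_eq:
  assumes "\<E> x < \<infinity>"
  shows "\<E> x = ereal (convex_part x + \<kappa>/2 * (norm x)\<^sup>2)"
  using assms energy_lower_bound[of x] by (cases "\<E> x") (auto simp: convex_part_def)

lemma convex_part_nonneg: "\<E> x < \<infinity> \<Longrightarrow> 0 \<le> convex_part x"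
  using energy_lower_bound[of x] by (simp add: energy_eq)

lemma energy_finite_on_Domain: "x \<in> Domain C \<Longrightarrow> \<E> x < \<infinity>"
  using lsc_regularization_le[of "quadratic_energy C \<kappa>" x]
  by (auto simp: \<E>_def quadratic_energy_eq[OF single_valued] dest!: le_less_trans)

text \<open>On the domain of \<open>C\<close> the energy without its curvature term is a nonnegative quadratic form,
  hence convex. Recovery sequences carry this over to the regularization. The curvature term is
  continuous, so it may be evaluated along these sequences.\<close>

lemma convex_on_convex_part: "convex_on {x. \<E> x < \<infinity>} convex_part"
proof -
  have key: "\<E> ((1-t) *\<^sub>R x + t *\<^sub>R y) \<le> ereal ((1-t) * convex_part x + t * convex_part y
      + \<kappa>/2 * (norm ((1-t) *\<^sub>R x + t *\<^sub>R y))\<^sup>2)"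
    if fin: "\<E> x < \<infinity>" "\<E> y < \<infinity>" and t: "0 < t" "t < 1" for x y t
  proof (rule ereal_le_epsilon2)
    fix e :: real assume "e > 0"
    obtain x' where x': "\<And>n. quadratic_energy C \<kappa> (x' n) < ereal (convex_part x + \<kappa>/2 * (norm x)\<^sup>2 + e)" "x' \<longlonglongrightarrow> x"
    proof (rule lsc_regularization_approx[of "quadratic_energy C \<kappa>" x])
      show "lsc_regularization (quadratic_energy C \<kappa>) x < ereal (convex_part x + \<kappa>/2 * (norm x)\<^sup>2 + e)"
        using energy_eq[OF fin(1)] \<open>e > 0\<close> by (simp flip: \<E>_def)
    qed (use that in blast)
    obtain y' where y': "\<And>n. quadratic_energy C \<kappa> (y' n) < ereal (convex_part y + \<kappa>/2 * (norm y)\<^sup>2 + e)" "y' \<longlonglongrightarrow> y"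
    proof (rule lsc_regularization_approx[of "quadratic_energy C \<kappa>" y])
      show "lsc_regularization (quadratic_energy C \<kappa>) y < ereal (convex_part y + \<kappa>/2 * (norm y)\<^sup>2 + e)"
        using energy_eq[OF fin(2)] \<open>e > 0\<close> by (simp flip: \<E>_def)
    qed (use that in blast)
    define z' where "z' n = (1-t) *\<^sub>R x' n + t *\<^sub>R y' n" for n
    define r where "r n = (1-t) * (convex_part x + \<kappa>/2 * (norm x)\<^sup>2 + e - \<kappa>/2 * (norm (x' n))\<^sup>2)
      + t * (convex_part y + \<kappa>/2 * (norm y)\<^sup>2 + e - \<kappa>/2 * (norm (y' n))\<^sup>2) + \<kappa>/2 * (norm (z' n))\<^sup>2" for n
    have lim: "z' \<longlonglongrightarrow> (1-t) *\<^sub>R x + t *\<^sub>R y" unfolding z'_def by (intro tendsto_intros x' y')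
    have "r \<longlonglongrightarrow> (1-t) * (convex_part x + \<kappa>/2 * (norm x)\<^sup>2 + e - \<kappa>/2 * (norm x)\<^sup>2)
      + t * (convex_part y + \<kappa>/2 * (norm y)\<^sup>2 + e - \<kappa>/2 * (norm y)\<^sup>2) + \<kappa>/2 * (norm ((1-t) *\<^sub>R x + t *\<^sub>R y))\<^sup>2"
      unfolding r_def by (intro tendsto_intros x' y' lim)
    moreover have "\<E> (z' n) \<le> ereal (r n)" for n
    proof -
      have "x' n \<in> Domain C" "y' n \<in> Domain C"
        using x'(1)[of n] y'(1)[of n] by (auto simp: quadratic_energy_def split: if_splits)
      then obtain \<xi> \<eta> where C: "(x' n, \<xi>) \<in> C" "(y' n, \<eta>) \<in> C" by auto
      have "(1-t) *\<^sub>R (x' n, \<xi>) + t *\<^sub>R (y' n, \<eta>) \<in> C"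
        by (intro subspace_add[OF subspace] subspace_scale[OF subspace] C)
      hence zC: "(z' n, (1-t) *\<^sub>R \<xi> + t *\<^sub>R \<eta>) \<in> C" by (simp add: z'_def)
      have "(\<xi> - \<eta>) \<bullet> (x' n - y' n) \<le> 0" using dissipative C by (force simp: dissipative_def)
      hence diss: "t * (1-t) * ((\<xi> - \<eta>) \<bullet> (x' n - y' n)) \<le> 0" using t by (intro mult_nonneg_nonpos) auto
      have ident: "- (1/2) * (((1-t) *\<^sub>R \<xi> + t *\<^sub>R \<eta>) \<bullet> z' n)
         = (1-t) * (- (1/2) * (\<xi> \<bullet> x' n)) + t * (- (1/2) * (\<eta> \<bullet> y' n))
           + 1/2 * (t * (1-t) * ((\<xi> - \<eta>) \<bullet> (x' n - y' n)))"
        by (simp add: z'_def inner_simps field_simps)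
      have "\<E> (z' n) \<le> quadratic_energy C \<kappa> (z' n)" unfolding \<E>_def by (rule lsc_regularization_le)
      also have "\<dots> = ereal (- (1/2) * (((1-t) *\<^sub>R \<xi> + t *\<^sub>R \<eta>) \<bullet> z' n) + \<kappa>/2 * (norm (z' n))\<^sup>2)"
        by (rule quadratic_energy_eq[OF single_valued zC])
      also have "\<dots> \<le> ereal (r n)"
      proof -
        have "(1-t) * (- (1/2) * (\<xi> \<bullet> x' n)) \<le> (1-t) * (convex_part x + \<kappa>/2 * (norm x)\<^sup>2 + e - \<kappa>/2 * (norm (x' n))\<^sup>2)"
          using x'(1)[of n] t by (intro mult_left_mono) (simp_all add: quadratic_energy_eq[OF single_valued C(1)])
        moreover have "t * (- (1/2) * (\<eta> \<bullet> y' n)) \<le> t * (convex_part y + \<kappa>/2 * (norm y)\<^sup>2 + e - \<kappa>/2 * (norm (y' n))\<^sup>2)"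
          using y'(1)[of n] t by (intro mult_left_mono) (simp_all add: quadratic_energy_eq[OF single_valued C(2)])
        ultimately show ?thesis unfolding ident r_def using diss by simp
      qed
      finally show ?thesis .
    qed
    moreover have "lower_semicontinuous \<E>" unfolding \<E>_def by (rule lsc_lsc_regularization)
    ultimately have "\<E> ((1-t) *\<^sub>R x + t *\<^sub>R y) \<le> ereal ((1-t) * (convex_part x + \<kappa>/2 * (norm x)\<^sup>2 + e - \<kappa>/2 * (norm x)\<^sup>2)
      + t * (convex_part y + \<kappa>/2 * (norm y)\<^sup>2 + e - \<kappa>/2 * (norm y)\<^sup>2) + \<kappa>/2 * (norm ((1-t) *\<^sub>R x + t *\<^sub>R y))\<^sup>2)"
      using lim by (intro lower_semicontinuous_seq_le)
    thus "\<E> ((1-t) *\<^sub>R x + t *\<^sub>R y) \<le> ereal ((1-t) * convex_part x + t * convex_part y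
      + \<kappa>/2 * (norm ((1-t) *\<^sub>R x + t *\<^sub>R y))\<^sup>2) + ereal e"
      by (simp add: algebra_simps)
  qed
  have fin: "\<E> ((1-t) *\<^sub>R x + t *\<^sub>R y) < \<infinity>"
    if "\<E> x < \<infinity>" "\<E> y < \<infinity>" "0 < t" "t < 1" for x y t
    using key[OF that] by (rule le_less_trans) simp
  show ?thesis
  proof (rule convex_onI)
    show "convex {x. \<E> x < \<infinity>}"
      unfolding convex_alt
    proof (intro ballI allI impI)
      fix x y t assume "x \<in> {x. \<E> x < \<infinity>}" "y \<in> {x. \<E> x < \<infinity>}" "(0::real) \<le> t \<and> t \<le> 1"
      thus "(1 - t) *\<^sub>R x + t *\<^sub>R y \<in> {x. \<E> x < \<infinity>}"
        using fin[of x y t] by (cases "t = 0 \<or> t = 1") auto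
    qed
    fix t :: real and x y assume "0 < t" "t < 1" "x \<in> {x. \<E> x < \<infinity>}" "y \<in> {x. \<E> x < \<infinity>}"
    thus "convex_part ((1 - t) *\<^sub>R x + t *\<^sub>R y) \<le> (1 - t) * convex_part x + t * convex_part y"
      using key[of x y t] energy_eq[OF fin[of x y t]] by simp
  qed
qed

end

section \<open>Reduction to quadratic test functions\<close>

text \<open>The viscosity inequality tested with \<open>a/2 * (norm (\<pi> - \<rho>))\<^sup>2\<close> alone. The test point \<open>\<pi>\<close> is a
  near-maximizer compared with one prescribed point \<open>x\<close>, and the Hamiltonian is written with the convex
  part \<open>q\<close> of the energy, which turns the curvature terms into the inner product. The sign \<open>s\<close> of the
  squared momentum is \<open>1\<close> for a subsolution and \<open>-1\<close> for the negative of a supersolution, so that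
  both inequalities take the same form.\<close>

definition quadratic_test_subsolution ::
    "real \<Rightarrow> real \<Rightarrow> ('a::real_inner \<Rightarrow> real) \<Rightarrow> 'a set \<Rightarrow> real \<Rightarrow> ('a \<Rightarrow> real) \<Rightarrow> ('a \<Rightarrow> real) \<Rightarrow> bool"
  where
  "quadratic_test_subsolution lam \<kappa> q D s h w \<longleftrightarrow>
     (\<forall>a>0. \<forall>\<rho>\<in>D. \<forall>x. \<forall>e>0. \<exists>\<pi>\<in>D.
        w x - a/2 * (norm (x - \<rho>))\<^sup>2 \<le> w \<pi> - a/2 * (norm (\<pi> - \<rho>))\<^sup>2 + e \<and>
        w \<pi> - h \<pi> \<le> lam * (a * (q \<rho> - q \<pi>) - a * \<kappa> * (\<pi> \<bullet> (\<pi> - \<rho>))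
          + s * (a\<^sup>2/2 * (norm (\<pi> - \<rho>))\<^sup>2)) + e)"

lemma tataru_dist_nonneg: "0 \<le> tataru_dist \<kappa> \<E> \<pi> \<mu>"
  unfolding tataru_dist_def by (intro cINF_greatest) auto

lemma bounded_range_abs_le:
  fixes w :: "'a \<Rightarrow> real"
  assumes "bounded (range w)"
  obtains M where "\<And>y. \<bar>w y\<bar> \<le> M"
  using assms by (auto simp: bounded_iff)

text \<open>Near-maximizers of \<open>w - a/2 * (dist _ \<rho>)\<^sup>2 - b * T\<close> stay in a ball around \<open>\<rho>\<close> whose radius does
  not depend on \<open>b \<le> 1\<close>: comparing with the competitor \<open>\<rho>\<close> bounds the quadratic term. Hence for small
  \<open>b\<close> all contributions of \<open>b\<close> are at most \<open>e\<close>, whatever the nonnegative function \<open>T\<close> is.\<close>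

lemma small_perturbation_negligible:
  fixes w T :: "'a::metric_space \<Rightarrow> real"
  assumes w: "bounded (range w)" and T: "\<And>y. 0 \<le> T y" and a: "a > 0" and e: "e > 0" and lam: "lam > 0"
  obtains b where "b > 0"
    "\<And>\<pi>. w \<rho> - b * T \<rho> - b \<le> w \<pi> - a/2 * (dist \<pi> \<rho>)\<^sup>2 - b * T \<pi> \<Longrightarrow>
         w x - a/2 * (dist x \<rho>)\<^sup>2 - b * T x - b \<le> w \<pi> - a/2 * (dist \<pi> \<rho>)\<^sup>2 - b * T \<pi> \<Longrightarrow>
         w x - a/2 * (dist x \<rho>)\<^sup>2 \<le> w \<pi> - a/2 * (dist \<pi> \<rho>)\<^sup>2 + e \<and>
         b + lam * (b + a * b * dist \<pi> \<rho> + 1/2 * b\<^sup>2) \<le> e"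
proof -
  obtain M where M: "\<And>y. \<bar>w y\<bar> \<le> M" using bounded_range_abs_le[OF w] by blast
  hence M0: "M \<ge> 0" by (meson abs_ge_zero order_trans)
  define K where "K = 2 * M + T \<rho> + 1"
  define R where "R = 1 + 2 * K / a"
  have K: "K \<ge> 0" and R: "R \<ge> 0" using M0 T[of \<rho>] a by (auto simp: K_def R_def)
  define Z where "Z = 1 + T x + lam * (2 + a * R)"
  have Z: "Z \<ge> 1 + T x" "Z \<ge> 1 + lam * (2 + a * R)" "Z \<ge> 1" using T[of x] lam a R by (auto simp: Z_def)
  define b where "b = min 1 (e / Z)"
  have b: "b > 0" "b \<le> 1" "b * Z \<le> e" using e Z by (auto simp: b_def min_def field_simps)
  show ?thesis
  proof (rule that[OF b(1)], intro conjI)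
    fix \<pi>
    assume 1: "w \<rho> - b * T \<rho> - b \<le> w \<pi> - a/2 * (dist \<pi> \<rho>)\<^sup>2 - b * T \<pi>"
      and 2: "w x - a/2 * (dist x \<rho>)\<^sup>2 - b * T x - b \<le> w \<pi> - a/2 * (dist \<pi> \<rho>)\<^sup>2 - b * T \<pi>"
    have bT: "0 \<le> b * T \<pi>" using b T by simp
    have "b * (T x + 1) \<le> b * Z" using b Z by (intro mult_left_mono) auto
    thus "w x - a/2 * (dist x \<rho>)\<^sup>2 \<le> w \<pi> - a/2 * (dist \<pi> \<rho>)\<^sup>2 + e"
      using 2 bT b by (simp add: algebra_simps)
    have "b * T \<rho> \<le> T \<rho>" using b T[of \<rho>] by (simp add: mult_left_le_one_le)
    hence "a/2 * (dist \<pi> \<rho>)\<^sup>2 \<le> K" using 1 bT b M[of \<rho>] M[of \<pi>] by (simp add: K_def)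
    hence "(dist \<pi> \<rho>)\<^sup>2 \<le> 2 * K / a" using a by (simp add: field_simps)
    moreover have "2 * dist \<pi> \<rho> \<le> 1 + (dist \<pi> \<rho>)\<^sup>2"
      using sum_squares_bound[of "dist \<pi> \<rho>" 1] by simp
    moreover have "0 \<le> dist \<pi> \<rho>" by simp
    ultimately have dR: "dist \<pi> \<rho> \<le> R" unfolding R_def by linarith
    have "b + lam * (b + a * b * dist \<pi> \<rho> + 1/2 * b\<^sup>2) = b * (1 + lam * (1 + a * dist \<pi> \<rho> + b/2))"
      by (simp add: algebra_simps power2_eq_square)
    also have "\<dots> \<le> b * (1 + lam * (2 + a * R))"
    proof -
      have "a * dist \<pi> \<rho> \<le> a * R" using dR a by simp
      hence "1 + a * dist \<pi> \<rho> + b/2 \<le> 2 + a * R" using b by linarith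
      thus ?thesis using b lam by (intro mult_left_mono add_left_mono) auto
    qed
    also have "\<dots> \<le> b * Z" using b Z by (intro mult_left_mono) auto
    finally show "b + lam * (b + a * b * dist \<pi> \<rho> + 1/2 * b\<^sup>2) \<le> e" using b by linarith
  qed
qed

context dissipative_quadratic_energy
begin

text \<open>Since \<open>b\<close> may be taken arbitrarily small after \<open>a\<close>, \<open>\<rho>\<close> and \<open>x\<close> have been fixed, the Tataru distance
  drops out. The value \<open>-\<infinity>\<close> of the upper Hamiltonian outside the domain of the energy forces the
  test point into the domain.\<close>

lemma subsolution_imp_quadratic_test:
  assumes lam: "lam > 0" and u: "viscosity_subsolution lam (H_dagger \<kappa> \<E>) h u"
  shows "quadratic_test_subsolution lam \<kappa> convex_part {x. \<E> x < \<infinity>} 1 h u"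
  unfolding quadratic_test_subsolution_def
proof (intro allI impI ballI)
  fix a :: real and \<rho> x and e :: real
  assume a: "a > 0" and \<rho>: "\<rho> \<in> {x. \<E> x < \<infinity>}" and e: "e > 0"
  define T where "T y = tataru_dist \<kappa> \<E> y 0" for y :: 'a
  have T: "\<And>y. 0 \<le> T y" unfolding T_def by (rule tataru_dist_nonneg)
  have bdd: "bounded (range u)" using u by (simp add: viscosity_subsolution_def)
  obtain b where b: "b > 0"
    and neg: "\<And>\<pi>. u \<rho> - b * T \<rho> - b \<le> u \<pi> - a/2 * (dist \<pi> \<rho>)\<^sup>2 - b * T \<pi> \<Longrightarrow>
         u x - a/2 * (dist x \<rho>)\<^sup>2 - b * T x - b \<le> u \<pi> - a/2 * (dist \<pi> \<rho>)\<^sup>2 - b * T \<pi> \<Longrightarrow>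
         u x - a/2 * (dist x \<rho>)\<^sup>2 \<le> u \<pi> - a/2 * (dist \<pi> \<rho>)\<^sup>2 + e \<and>
         b + lam * (b + a * b * dist \<pi> \<rho> + 1/2 * b\<^sup>2) \<le> e"
    by (rule small_perturbation_negligible[OF bdd T a e lam, where \<rho> = \<rho> and x = x], rule that)
  define f where "f y = 1/2 * a * (dist y \<rho>)\<^sup>2 + b * tataru_dist \<kappa> \<E> y 0 + 0" for y
  define g where "g y = ereal a * (\<E> \<rho> - \<E> y)
            + ereal (- a * (\<kappa>/2) * (dist y \<rho>)\<^sup>2 + b + 1/2 * a\<^sup>2 * (dist y \<rho>)\<^sup>2
                     + a * b * dist y \<rho> + 1/2 * b\<^sup>2)" for y
  have "(f, g) \<in> H_dagger \<kappa> \<E>"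
    unfolding H_dagger_def f_def g_def using a b \<rho> by blast
  then obtain p where p: "(\<lambda>n. ereal (u (p n) - f (p n))) \<longlonglongrightarrow> (SUP x. ereal (u x - f x))"
      "limsup (\<lambda>n. ereal (u (p n)) - ereal lam * g (p n) - ereal (h (p n))) \<le> 0"
    using u unfolding viscosity_subsolution_def by blast
  have ev: "\<forall>\<^sub>F n in sequentially. u y - f y - b < u (p n) - f (p n)" for y
  proof -
    have "ereal (u y - f y - b) < ereal (u y - f y)" using b by simp
    also have "\<dots> \<le> (SUP x. ereal (u x - f x))" by (rule SUP_upper) simp
    finally show ?thesis using order_tendstoD(1)[OF p(1)] by fastforce
  qed
  have "limsup (\<lambda>n. ereal (u (p n)) - ereal lam * g (p n) - ereal (h (p n))) < ereal b"
    by (rule le_less_trans[OF p(2)]) (use b in simp)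
  from Limsup_lessD[OF this] ev[of \<rho>] ev[of x]
  have "\<forall>\<^sub>F n in sequentially. ereal (u (p n)) - ereal lam * g (p n) - ereal (h (p n)) < ereal b
      \<and> u \<rho> - f \<rho> - b < u (p n) - f (p n) \<and> u x - f x - b < u (p n) - f (p n)"
    by eventually_elim simp
  then obtain \<pi> where \<pi>: "ereal (u \<pi>) - ereal lam * g \<pi> - ereal (h \<pi>) < ereal b"
      "u \<rho> - f \<rho> - b < u \<pi> - f \<pi>" "u x - f x - b < u \<pi> - f \<pi>"
    by (auto simp: eventually_sequentially)
  have small: "u x - a/2 * (dist x \<rho>)\<^sup>2 \<le> u \<pi> - a/2 * (dist \<pi> \<rho>)\<^sup>2 + e"
      "b + lam * (b + a * b * dist \<pi> \<rho> + 1/2 * b\<^sup>2) \<le> e"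
    using neg[of \<pi>] \<pi>(2,3) by (auto simp: f_def T_def)
  have E\<rho>: "\<E> \<rho> = ereal (convex_part \<rho> + \<kappa>/2 * (norm \<rho>)\<^sup>2)" using \<rho> energy_eq by simp
  have fin: "\<E> \<pi> < \<infinity>"
  proof (rule ccontr)
    assume "\<not> ?thesis"
    hence "g \<pi> = - \<infinity>" using a by (simp add: g_def E\<rho>)
    thus False using \<pi>(1) lam by simp
  qed
  have "u \<pi> - h \<pi> < lam * (a * (convex_part \<rho> + \<kappa>/2 * (norm \<rho>)\<^sup>2 - (convex_part \<pi> + \<kappa>/2 * (norm \<pi>)\<^sup>2))
      + (- a * (\<kappa>/2) * (dist \<pi> \<rho>)\<^sup>2 + b + 1/2 * a\<^sup>2 * (dist \<pi> \<rho>)\<^sup>2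
                     + a * b * dist \<pi> \<rho> + 1/2 * b\<^sup>2)) + b"
    using \<pi>(1) unfolding g_def E\<rho> energy_eq[OF fin] by simp
  also have "\<dots> = lam * (a * (convex_part \<rho> - convex_part \<pi>) - a * \<kappa> * (\<pi> \<bullet> (\<pi> - \<rho>))
          + 1 * (a\<^sup>2/2 * (norm (\<pi> - \<rho>))\<^sup>2)) + (b + lam * (b + a * b * dist \<pi> \<rho> + 1/2 * b\<^sup>2))"
  proof -
    have "\<kappa>/2 * (norm \<rho>)\<^sup>2 - \<kappa>/2 * (norm \<pi>)\<^sup>2 - \<kappa>/2 * (norm (\<pi> - \<rho>))\<^sup>2 = - \<kappa> * (\<pi> \<bullet> (\<pi> - \<rho>))"
      unfolding power2_norm_eq_inner by (simp add: inner_simps inner_commute field_simps)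
    hence "a * (\<kappa>/2 * (norm \<rho>)\<^sup>2 - \<kappa>/2 * (norm \<pi>)\<^sup>2 - \<kappa>/2 * (norm (\<pi> - \<rho>))\<^sup>2) = a * (- \<kappa> * (\<pi> \<bullet> (\<pi> - \<rho>)))"
      by simp
    hence "lam * (a * (\<kappa>/2 * (norm \<rho>)\<^sup>2 - \<kappa>/2 * (norm \<pi>)\<^sup>2 - \<kappa>/2 * (norm (\<pi> - \<rho>))\<^sup>2)) = lam * (a * (- \<kappa> * (\<pi> \<bullet> (\<pi> - \<rho>))))"
      by simp
    thus ?thesis by (simp add: dist_norm algebra_simps)
  qed
  finally have "u \<pi> - h \<pi> \<le> lam * (a * (convex_part \<rho> - convex_part \<pi>) - a * \<kappa> * (\<pi> \<bullet> (\<pi> - \<rho>))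
          + 1 * (a\<^sup>2/2 * (norm (\<pi> - \<rho>))\<^sup>2)) + e" using small(2) by linarith
  thus "\<exists>\<pi>\<in>{x. \<E> x < \<infinity>}. u x - a/2 * (norm (x - \<rho>))\<^sup>2 \<le> u \<pi> - a/2 * (norm (\<pi> - \<rho>))\<^sup>2 + e \<and>
        u \<pi> - h \<pi> \<le> lam * (a * (convex_part \<rho> - convex_part \<pi>) - a * \<kappa> * (\<pi> \<bullet> (\<pi> - \<rho>))
          + 1 * (a\<^sup>2/2 * (norm (\<pi> - \<rho>))\<^sup>2)) + e"
    using small(1) fin by (intro bexI[of _ \<pi>]) (auto simp: dist_norm)
qed

lemma supersolution_imp_quadratic_test:
  assumes lam: "lam > 0" and v: "viscosity_supersolution lam (H_ddagger \<kappa> \<E>) h v"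
  shows "quadratic_test_subsolution lam \<kappa> convex_part {x. \<E> x < \<infinity>} (-1) (\<lambda>x. - h x) (\<lambda>x. - v x)"
  unfolding quadratic_test_subsolution_def
proof (intro allI impI ballI)
  fix a :: real and \<gamma> x and e :: real
  assume a: "a > 0" and \<gamma>: "\<gamma> \<in> {x. \<E> x < \<infinity>}" and e: "e > 0"
  define T where "T y = tataru_dist \<kappa> \<E> y 0" for y :: 'a
  have T: "\<And>y. 0 \<le> T y" unfolding T_def by (rule tataru_dist_nonneg)
  have bdd: "bounded (range (\<lambda>x. - v x))"
    using v by (auto simp: viscosity_supersolution_def bounded_iff)
  obtain b where b: "b > 0"
    and neg: "\<And>\<mu>. - v \<gamma> - b * T \<gamma> - b \<le> - v \<mu> - a/2 * (dist \<mu> \<gamma>)\<^sup>2 - b * T \<mu> \<Longrightarrow>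
         - v x - a/2 * (dist x \<gamma>)\<^sup>2 - b * T x - b \<le> - v \<mu> - a/2 * (dist \<mu> \<gamma>)\<^sup>2 - b * T \<mu> \<Longrightarrow>
         - v x - a/2 * (dist x \<gamma>)\<^sup>2 \<le> - v \<mu> - a/2 * (dist \<mu> \<gamma>)\<^sup>2 + e \<and>
         b + lam * (b + a * b * dist \<mu> \<gamma> + 1/2 * b\<^sup>2) \<le> e"
    by (rule small_perturbation_negligible[OF bdd T a e lam, where \<rho> = \<gamma> and x = x], rule that)
  define f where "f y = - (1/2) * a * (dist \<gamma> y)\<^sup>2 - b * tataru_dist \<kappa> \<E> y 0 + 0" for y
  define g where "g y = ereal a * (\<E> y - \<E> \<gamma>)
            + ereal (a * (\<kappa>/2) * (dist \<gamma> y)\<^sup>2 - b + 1/2 * a\<^sup>2 * (dist \<gamma> y)\<^sup>2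
                     - a * b * dist \<gamma> y - 1/2 * b\<^sup>2)" for y
  have "(f, g) \<in> H_ddagger \<kappa> \<E>"
    unfolding H_ddagger_def f_def g_def using a b \<gamma> by blast
  then obtain p where p: "(\<lambda>n. ereal (v (p n) - f (p n))) \<longlonglongrightarrow> (INF x. ereal (v x - f x))"
      "liminf (\<lambda>n. ereal (v (p n)) - ereal lam * g (p n) - ereal (h (p n))) \<ge> 0"
    using v unfolding viscosity_supersolution_def by blast
  have ev: "\<forall>\<^sub>F n in sequentially. v (p n) - f (p n) < v y - f y + b" for y
  proof -
    have "(INF x. ereal (v x - f x)) \<le> ereal (v y - f y)" by (rule INF_lower) simp
    also have "\<dots> < ereal (v y - f y + b)" using b by simp
    finally show ?thesis using order_tendstoD(2)[OF p(1)] by fastforce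
  qed
  have "ereal (- b) < liminf (\<lambda>n. ereal (v (p n)) - ereal lam * g (p n) - ereal (h (p n)))"
    by (rule less_le_trans[OF _ p(2)]) (use b in simp)
  from less_LiminfD[OF this] ev[of \<gamma>] ev[of x]
  have "\<forall>\<^sub>F n in sequentially. ereal (- b) < ereal (v (p n)) - ereal lam * g (p n) - ereal (h (p n))
      \<and> v (p n) - f (p n) < v \<gamma> - f \<gamma> + b \<and> v (p n) - f (p n) < v x - f x + b"
    by eventually_elim simp
  then obtain \<mu> where \<mu>: "ereal (- b) < ereal (v \<mu>) - ereal lam * g \<mu> - ereal (h \<mu>)"
      "v \<mu> - f \<mu> < v \<gamma> - f \<gamma> + b" "v \<mu> - f \<mu> < v x - f x + b"
    by (auto simp: eventually_sequentially)
  have small: "- v x - a/2 * (dist x \<gamma>)\<^sup>2 \<le> - v \<mu> - a/2 * (dist \<mu> \<gamma>)\<^sup>2 + e"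
      "b + lam * (b + a * b * dist \<mu> \<gamma> + 1/2 * b\<^sup>2) \<le> e"
    using neg[of \<mu>] \<mu>(2,3) by (auto simp: f_def T_def dist_commute)
  have E\<gamma>: "\<E> \<gamma> = ereal (convex_part \<gamma> + \<kappa>/2 * (norm \<gamma>)\<^sup>2)" using \<gamma> energy_eq by simp
  have fin: "\<E> \<mu> < \<infinity>"
  proof (rule ccontr)
    assume "\<not> ?thesis"
    hence "g \<mu> = \<infinity>" using a by (simp add: g_def E\<gamma>)
    thus False using \<mu>(1) lam by simp
  qed
  have "- v \<mu> - (- h \<mu>) < lam * (a * (convex_part \<gamma> + \<kappa>/2 * (norm \<gamma>)\<^sup>2 - (convex_part \<mu> + \<kappa>/2 * (norm \<mu>)\<^sup>2))
      - (a * (\<kappa>/2) * (dist \<mu> \<gamma>)\<^sup>2 - b + 1/2 * a\<^sup>2 * (dist \<mu> \<gamma>)\<^sup>2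
                     - a * b * dist \<mu> \<gamma> - 1/2 * b\<^sup>2)) + b"
    using \<mu>(1) unfolding g_def E\<gamma> energy_eq[OF fin] dist_commute[of \<gamma> \<mu>] by (simp add: algebra_simps)
  also have "\<dots> = lam * (a * (convex_part \<gamma> - convex_part \<mu>) - a * \<kappa> * (\<mu> \<bullet> (\<mu> - \<gamma>))
          + -1 * (a\<^sup>2/2 * (norm (\<mu> - \<gamma>))\<^sup>2)) + (b + lam * (b + a * b * dist \<mu> \<gamma> + 1/2 * b\<^sup>2))"
  proof -
    have "\<kappa>/2 * (norm \<gamma>)\<^sup>2 - \<kappa>/2 * (norm \<mu>)\<^sup>2 - \<kappa>/2 * (norm (\<mu> - \<gamma>))\<^sup>2 = - \<kappa> * (\<mu> \<bullet> (\<mu> - \<gamma>))"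
      unfolding power2_norm_eq_inner by (simp add: inner_simps inner_commute field_simps)
    hence "lam * (a * (\<kappa>/2 * (norm \<gamma>)\<^sup>2 - \<kappa>/2 * (norm \<mu>)\<^sup>2 - \<kappa>/2 * (norm (\<mu> - \<gamma>))\<^sup>2)) = lam * (a * (- \<kappa> * (\<mu> \<bullet> (\<mu> - \<gamma>))))"
      by simp
    thus ?thesis by (simp add: dist_norm algebra_simps)
  qed
  finally have "- v \<mu> - (- h \<mu>) \<le> lam * (a * (convex_part \<gamma> - convex_part \<mu>) - a * \<kappa> * (\<mu> \<bullet> (\<mu> - \<gamma>))
          + -1 * (a\<^sup>2/2 * (norm (\<mu> - \<gamma>))\<^sup>2)) + e" using small(2) by linarith
  thus "\<exists>\<mu>\<in>{x. \<E> x < \<infinity>}. - v x - a/2 * (norm (x - \<gamma>))\<^sup>2 \<le> - v \<mu> - a/2 * (norm (\<mu> - \<gamma>))\<^sup>2 + e \<and>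
        - v \<mu> - (- h \<mu>) \<le> lam * (a * (convex_part \<gamma> - convex_part \<mu>) - a * \<kappa> * (\<mu> \<bullet> (\<mu> - \<gamma>))
          + -1 * (a\<^sup>2/2 * (norm (\<mu> - \<gamma>))\<^sup>2)) + e"
    using small(1) fin by (intro bexI[of _ \<mu>]) (auto simp: dist_norm)
qed

end

section \<open>Slopes, Hamiltonians and parameters of the quadruplication\<close>

definition chain_cost :: "'a::real_normed_vector \<Rightarrow> 'a \<Rightarrow> 'a \<Rightarrow> 'a \<Rightarrow> real" where
  "chain_cost x \<rho> \<gamma> y = ((norm (x - \<rho>))\<^sup>2 + (norm (\<rho> - \<gamma>))\<^sup>2 + (norm (\<gamma> - y))\<^sup>2) / 2"

definition energy_cost :: "('a::real_normed_vector \<Rightarrow> real) \<Rightarrow> 'a \<Rightarrow> real" where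
  "energy_cost q \<rho> = q \<rho> + (norm \<rho>)\<^sup>2 / 2"

lemma inner_le_weighted_squares:
  fixes x y :: "'a::real_inner"
  assumes "c > 0"
  shows "x \<bullet> y \<le> c * (norm x)\<^sup>2 + (norm y)\<^sup>2 / (4 * c)"
proof -
  have "0 \<le> (norm ((2 * c) *\<^sub>R x - y))\<^sup>2" by simp
  also have "\<dots> = 4 * c\<^sup>2 * (norm x)\<^sup>2 - 4 * c * (x \<bullet> y) + (norm y)\<^sup>2"
    unfolding power2_norm_eq_inner
    by (simp add: inner_diff inner_commute power2_eq_square algebra_simps)
  finally show ?thesis using assms by (simp add: field_simps power2_eq_square)
qed

text \<open>The vector \<open>w\<close> is minus the gradient in \<open>\<rho>\<close> of the quadratic costs, so they decrease at rate
  \<open>(norm w)\<^sup>2\<close> along the segment \<open>\<rho> + s w\<close>. This point is also a convex combination of \<open>\<rho>\<close>, \<open>\<pi>\<close> and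
  \<open>\<gamma>\<close>, so convexity of \<open>q\<close> bounds its energy by the three given energies. By near-maximality the
  energy must grow at least as fast as the quadratic costs decrease. In the resulting bound on the
  energy difference of the Hamiltonian, \<open>\<beta> * (q \<gamma> - q \<rho>)\<close> cancels once the roles of \<open>\<rho>\<close> and \<open>\<gamma>\<close> are
  exchanged and both bounds are added, and the negative square is large because \<open>\<epsilon>\<close> is small.\<close>

lemma energy_slope_at_near_maximizer:
  fixes q :: "'a::real_inner \<Rightarrow> real"
  assumes D: "convex_on D q"
    and \<beta>: "\<beta> > 0" and \<epsilon>: "0 < \<epsilon>" "\<epsilon> \<le> 1"
    and mem: "\<rho> \<in> D" "\<pi> \<in> D" "\<gamma> \<in> D"
    and max: "\<And>\<rho>'. \<rho>' \<in> D \<Longrightarrow>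
      - \<beta>/2 * ((norm (\<pi> - \<rho>'))\<^sup>2 + (norm (\<rho>' - \<gamma>))\<^sup>2) - \<epsilon> * energy_cost q \<rho>'
      \<le> - \<beta>/2 * ((norm (\<pi> - \<rho>))\<^sup>2 + (norm (\<rho> - \<gamma>))\<^sup>2) - \<epsilon> * energy_cost q \<rho> + \<eta>"
  defines "w \<equiv> \<beta> *\<^sub>R (\<pi> - \<rho>) - \<beta> *\<^sub>R (\<rho> - \<gamma>)"
  shows "\<beta> * (q \<rho> - q \<pi>)
    \<le> \<beta> * (q \<gamma> - q \<rho>) - 7/8 * (norm w)\<^sup>2 / \<epsilon> + \<rho> \<bullet> w + 8 * (\<beta> + 1) * \<eta> / \<epsilon>"
proof -
  \<comment> \<open>This step length keeps \<open>\<rho> + s w\<close> a convex combination and lets the second-order term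
    consume only one eighth of \<open>(norm w)\<^sup>2\<close>.\<close>
  define s where "s = 1 / (8 * (\<beta> + 1))"
  have s: "s > 0" "2 * s * \<beta> \<le> 1" using \<beta> by (auto simp: s_def field_simps)
  have seps: "s * (\<beta> + \<epsilon>/2) \<le> 1/8"
    using \<beta> \<epsilon> by (auto simp: s_def field_simps)
  define z where "z = s *\<^sub>R w"
  have mid: "(1/2) *\<^sub>R \<pi> + (1/2) *\<^sub>R \<gamma> \<in> D" "q ((1/2) *\<^sub>R \<pi> + (1/2) *\<^sub>R \<gamma>) \<le> q \<pi> / 2 + q \<gamma> / 2"
    using convex_onD[OF D, of "1/2" \<pi> \<gamma>] mem convexD[OF convex_on_imp_convex[OF D], of \<pi> \<gamma> "1/2" "1/2"]
    by (auto simp: field_simps)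
  have zeq: "\<rho> + z = (1 - 2 * s * \<beta>) *\<^sub>R \<rho> + (2 * s * \<beta>) *\<^sub>R ((1/2) *\<^sub>R \<pi> + (1/2) *\<^sub>R \<gamma>)"
    unfolding z_def w_def by (simp add: algebra_simps scaleR_left_distrib[symmetric])
  have inD: "\<rho> + z \<in> D"
    unfolding zeq using convexD[OF convex_on_imp_convex[OF D], of \<rho> _ "1 - 2 * s * \<beta>" "2 * s * \<beta>"] mid mem s \<beta> by auto
  have qz: "q (\<rho> + z) - q \<rho> \<le> s * (\<beta> * (q \<pi> - q \<rho>) + \<beta> * (q \<gamma> - q \<rho>))"
  proof -
    have "q (\<rho> + z) \<le> (1 - 2 * s * \<beta>) * q \<rho> + (2 * s * \<beta>) * q ((1/2) *\<^sub>R \<pi> + (1/2) *\<^sub>R \<gamma>)"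
      unfolding zeq using convex_onD[OF D, of "2 * s * \<beta>" \<rho>] mid mem s \<beta> by auto
    also have "\<dots> \<le> (1 - 2 * s * \<beta>) * q \<rho> + (2 * s * \<beta>) * (q \<pi> / 2 + q \<gamma> / 2)"
      using mid s \<beta> by (intro add_mono mult_left_mono) auto
    finally show ?thesis by (simp add: algebra_simps)
  qed
  have expand: "- \<beta>/2 * ((norm (\<pi> - (\<rho> + z)))\<^sup>2 + (norm ((\<rho> + z) - \<gamma>))\<^sup>2) - \<epsilon>/2 * (norm (\<rho> + z))\<^sup>2
     = - \<beta>/2 * ((norm (\<pi> - \<rho>))\<^sup>2 + (norm (\<rho> - \<gamma>))\<^sup>2) - \<epsilon>/2 * (norm \<rho>)\<^sup>2
       + w \<bullet> z - \<epsilon> * (\<rho> \<bullet> z) - (\<beta> + \<epsilon>/2) * (norm z)\<^sup>2"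
    unfolding w_def power2_norm_eq_inner
    by (simp add: inner_diff_left inner_diff_right inner_add_left inner_add_right inner_commute field_simps)
  have "w \<bullet> z - \<epsilon> * (\<rho> \<bullet> z) - (\<beta> + \<epsilon>/2) * (norm z)\<^sup>2 \<le> \<epsilon> * (q (\<rho> + z) - q \<rho>) + \<eta>"
    using max[OF inD] expand by (simp add: energy_cost_def algebra_simps)
  also have "\<dots> \<le> \<epsilon> * (s * (\<beta> * (q \<pi> - q \<rho>) + \<beta> * (q \<gamma> - q \<rho>))) + \<eta>"
    using qz \<epsilon> by simp
  finally have "s * ((norm w)\<^sup>2 - \<epsilon> * (\<rho> \<bullet> w) - s * (\<beta> + \<epsilon>/2) * (norm w)\<^sup>2)
      \<le> s * (\<epsilon> * (\<beta> * (q \<pi> - q \<rho>) + \<beta> * (q \<gamma> - q \<rho>)) + \<eta> / s)"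
    using s by (simp add: z_def power2_norm_eq_inner power2_eq_square[of s] algebra_simps)
  hence "(norm w)\<^sup>2 - \<epsilon> * (\<rho> \<bullet> w) - s * (\<beta> + \<epsilon>/2) * (norm w)\<^sup>2
      \<le> \<epsilon> * (\<beta> * (q \<pi> - q \<rho>) + \<beta> * (q \<gamma> - q \<rho>)) + \<eta> / s"
    using s by (simp only: mult_le_cancel_left_pos)
  moreover have "s * (\<beta> + \<epsilon>/2) * (norm w)\<^sup>2 \<le> 1/8 * (norm w)\<^sup>2"
    using seps by (intro mult_right_mono) auto
  moreover have "\<eta> / s = 8 * (\<beta> + 1) * \<eta>" using \<beta> by (simp add: s_def)
  ultimately have "7/8 * (norm w)\<^sup>2 - \<epsilon> * (\<rho> \<bullet> w) - 8 * (\<beta> + 1) * \<eta> \<le> \<epsilon> * (\<beta> * (q \<pi> - q \<rho>) + \<beta> * (q \<gamma> - q \<rho>))"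
    by linarith
  hence "(7/8 * (norm w)\<^sup>2 - \<epsilon> * (\<rho> \<bullet> w) - 8 * (\<beta> + 1) * \<eta>) / \<epsilon> \<le> \<beta> * (q \<pi> - q \<rho>) + \<beta> * (q \<gamma> - q \<rho>)"
    using \<epsilon> by (simp add: pos_divide_le_eq mult.commute)
  moreover have "(7/8 * (norm w)\<^sup>2 - \<epsilon> * (\<rho> \<bullet> w) - 8 * (\<beta> + 1) * \<eta>) / \<epsilon>
      = 7/8 * (norm w)\<^sup>2 / \<epsilon> - \<rho> \<bullet> w - 8 * (\<beta> + 1) * \<eta> / \<epsilon>"
    using \<epsilon> by (simp add: diff_divide_distrib)
  ultimately show ?thesis by (simp add: algebra_simps)
qed

text \<open>For fixed \<open>\<beta>\<close> let \<open>N \<beta>\<close> be the limit of \<open>S \<beta> \<epsilon>\<close> as \<open>\<epsilon>\<close> tends to 0. It decreases in \<open>\<beta>\<close> and is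
  bounded below by \<open>\<theta>\<close>, so \<open>N (2 ^ k)\<close> is a Cauchy sequence, and some halving of \<open>\<beta>\<close> hardly changes
  it. The gap between \<open>S (\<beta>/2) (\<epsilon>/2)\<close> and \<open>S \<beta> \<epsilon>\<close> later bounds half of the total penalty at a
  near-maximizer, up to the accuracy of the maximization.\<close>

lemma doubling_parameters:
  fixes S :: "real \<Rightarrow> real \<Rightarrow> real"
  assumes anti: "\<And>\<beta> \<beta>' \<epsilon> \<epsilon>'. 0 < \<beta> \<Longrightarrow> \<beta> \<le> \<beta>' \<Longrightarrow> 0 < \<epsilon> \<Longrightarrow> \<epsilon> \<le> \<epsilon>' \<Longrightarrow> S \<beta>' \<epsilon>' \<le> S \<beta> \<epsilon>"
    and ub: "\<And>\<beta> \<epsilon>. 0 < \<beta> \<Longrightarrow> 0 < \<epsilon> \<Longrightarrow> S \<beta> \<epsilon> \<le> M"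
    and lb: "\<And>\<beta> \<zeta>. 0 < \<beta> \<Longrightarrow> 0 < \<zeta> \<Longrightarrow> \<exists>\<epsilon>>0. \<theta> - \<zeta> \<le> S \<beta> \<epsilon>"
    and \<zeta>: "\<zeta> > 0"
  obtains \<beta> \<epsilon> where "\<beta> \<ge> 1" "0 < \<epsilon>" "\<epsilon> \<le> 1/4" "\<epsilon> * \<beta> \<le> 1"
    "\<theta> - \<zeta> \<le> S \<beta> \<epsilon>" "S (\<beta>/2) (\<epsilon>/2) \<le> S \<beta> \<epsilon> + \<zeta>"
proof -
  define N where "N \<beta> = (SUP \<epsilon>\<in>{0<..}. S \<beta> \<epsilon>)" for \<beta>
  have bdd: "bdd_above (S \<beta> ` {0<..})" if "\<beta> > 0" for \<beta>
    using ub that by (auto intro!: bdd_aboveI[where M=M])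
  have SN: "S \<beta> \<epsilon> \<le> N \<beta>" if "\<beta> > 0" "\<epsilon> > 0" for \<beta> \<epsilon>
    unfolding N_def using that by (intro cSUP_upper bdd) auto
  have Nanti: "N \<beta>' \<le> N \<beta>" if "0 < \<beta>" "\<beta> \<le> \<beta>'" for \<beta> \<beta>'
    unfolding N_def using that by (intro cSUP_mono bdd) (auto intro: anti)
  have N\<theta>: "\<theta> \<le> N \<beta>" if \<beta>: "\<beta> > 0" for \<beta>
  proof (rule field_le_epsilon)
    fix e :: real assume "e > 0"
    then obtain \<epsilon> where "\<epsilon> > 0" "\<theta> - e \<le> S \<beta> \<epsilon>" using lb[OF \<beta>] by blast
    thus "\<theta> \<le> N \<beta> + e" using SN[OF \<beta>, of \<epsilon>] by linarith
  qed
  have "decseq (\<lambda>k. N (2 ^ k))"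
    by (intro decseq_SucI Nanti) auto
  then obtain L where "(\<lambda>k. N (2 ^ k)) \<longlonglongrightarrow> L"
    by (rule decseq_convergent[of _ \<theta>]) (auto intro: N\<theta>)
  hence "(\<lambda>k. N (2 ^ k) - N (2 ^ Suc k)) \<longlonglongrightarrow> L - L"
    by (intro tendsto_diff LIMSEQ_Suc)
  hence "\<forall>\<^sub>F k in sequentially. N (2 ^ k) - N (2 ^ Suc k) < \<zeta>/2"
    using \<zeta> by (intro order_tendstoD(2)) auto
  then obtain k where k: "N (2 ^ k) - N (2 ^ Suc k) < \<zeta>/2"
    by (auto simp: eventually_sequentially)
  define \<beta> :: real where "\<beta> = 2 ^ Suc k"
  have \<beta>: "\<beta> \<ge> 1" "\<beta>/2 = 2 ^ k" by (auto simp: \<beta>_def simp del: power_Suc) simp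
  have "\<exists>\<epsilon>\<in>{0<..}. N \<beta> - \<zeta>/2 < S \<beta> \<epsilon>"
    unfolding N_def using \<beta> \<zeta> by (subst less_cSUP_iff[symmetric]) (auto intro!: bdd)
  then obtain \<epsilon>0 where \<epsilon>0: "\<epsilon>0 > 0" "N \<beta> - \<zeta>/2 < S \<beta> \<epsilon>0" by auto
  define \<epsilon> where "\<epsilon> = min \<epsilon>0 (min (1/4) (1/\<beta>))"
  have \<epsilon>: "\<epsilon> > 0" "\<epsilon> \<le> \<epsilon>0" "\<epsilon> \<le> 1/4" "\<epsilon> \<le> 1/\<beta>" using \<epsilon>0 \<beta> by (auto simp: \<epsilon>_def)
  have S\<epsilon>: "N \<beta> - \<zeta>/2 < S \<beta> \<epsilon>" using anti[of \<beta> \<beta> \<epsilon> \<epsilon>0] \<epsilon> \<epsilon>0 \<beta> by auto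
  show ?thesis
  proof (rule that[of \<beta> \<epsilon>])
    show "\<epsilon> * \<beta> \<le> 1" using \<epsilon>(4) \<beta> by (simp add: field_simps)
    show "\<theta> - \<zeta> \<le> S \<beta> \<epsilon>" using S\<epsilon> N\<theta>[of \<beta>] \<beta> \<zeta> by linarith
    have "S (\<beta>/2) (\<epsilon>/2) \<le> N (\<beta>/2)" using SN \<beta> \<epsilon> by auto
    thus "S (\<beta>/2) (\<epsilon>/2) \<le> S \<beta> \<epsilon> + \<zeta>"
      using k S\<epsilon> \<beta> by (simp add: \<beta>_def)
  qed (use \<beta> \<epsilon> in auto)
qed

text \<open>What remains of the difference of the two Hamiltonians after the energies have cancelled. With
  \<open>P = \<beta> *\<^sub>R (\<rho> - \<gamma>)\<close> the two momenta are \<open>P + w\<close> and \<open>P - w'\<close>, so their squares differ only by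
  terms that contain \<open>w\<close> or \<open>w'\<close>. These, and all others of this kind, are absorbed by
  \<open>- (norm w)\<^sup>2 / \<epsilon>\<close> at the price of \<open>\<epsilon>\<close> times squares that the penalties control. The terms without
  \<open>w\<close> come from the curvature \<open>\<kappa>\<close> and are bounded by the quadratic costs.\<close>

lemma hamiltonian_gap:
  fixes \<pi> \<rho> \<gamma> \<mu> :: "'a::real_inner"
  assumes \<beta>: "\<beta> \<ge> 1" and \<epsilon>: "0 < \<epsilon>" "\<epsilon> \<le> 1/4" "\<epsilon> * \<beta> \<le> 1"
    and chain: "\<beta> * (norm (\<pi> - \<rho>))\<^sup>2 \<le> 2 * \<sigma>" "\<beta> * (norm (\<rho> - \<gamma>))\<^sup>2 \<le> 2 * \<sigma>" "\<beta> * (norm (\<gamma> - \<mu>))\<^sup>2 \<le> 2 * \<sigma>"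
    and size: "\<epsilon> * (norm \<rho>)\<^sup>2 \<le> 2 * \<sigma>" "\<epsilon> * (norm \<gamma>)\<^sup>2 \<le> 2 * \<sigma>"
  defines "w \<equiv> \<beta> *\<^sub>R (\<pi> - \<rho>) - \<beta> *\<^sub>R (\<rho> - \<gamma>)" and "w' \<equiv> \<beta> *\<^sub>R (\<rho> - \<gamma>) - \<beta> *\<^sub>R (\<gamma> - \<mu>)"
  shows "- 7/8 * (norm w)\<^sup>2 / \<epsilon> - 7/8 * (norm w')\<^sup>2 / \<epsilon> + \<rho> \<bullet> w + \<gamma> \<bullet> w'
      - \<beta> * \<kappa> * (\<pi> \<bullet> (\<pi> - \<rho>)) - \<beta> * \<kappa> * (\<mu> \<bullet> (\<mu> - \<gamma>))
      + \<beta>\<^sup>2/2 * (norm (\<pi> - \<rho>))\<^sup>2 - \<beta>\<^sup>2/2 * (norm (\<mu> - \<gamma>))\<^sup>2 \<le> (16 + 12 * \<kappa>\<^sup>2 + 6 * \<bar>\<kappa>\<bar>) * \<sigma>"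
proof -
  define A B G P where "A = \<pi> - \<rho>" and "B = \<rho> - \<gamma>" and "G = \<gamma> - \<mu>" and "P = \<beta> *\<^sub>R B"
  have \<epsilon>\<beta>: "\<epsilon> \<le> \<beta>" using \<epsilon> \<beta> by linarith
  have \<sigma>: "\<sigma> \<ge> 0" using size(1) \<epsilon> by (smt (verit) zero_le_mult_iff zero_le_power2)
  have P: "\<epsilon> * (norm P)\<^sup>2 \<le> 2 * \<sigma>"
  proof -
    have "\<epsilon> * (norm P)\<^sup>2 = (\<epsilon> * \<beta>) * (\<beta> * (norm B)\<^sup>2)"
      using \<beta> by (simp add: P_def power_mult_distrib power2_eq_square)
    also have "\<dots> \<le> 1 * (2 * \<sigma>)"
      unfolding B_def using \<epsilon>(3) \<beta> chain(2) by (intro mult_mono[OF \<epsilon>(3) chain(2)]) simp_all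
    finally show ?thesis by simp
  qed
  \<comment> \<open>Every inner product with \<open>w\<close> is split by a weighted Young inequality; the weights are
    chosen so that, with \<open>(norm w)\<^sup>2 / 2\<close> included, the multiples of \<open>(norm w)\<^sup>2 / \<epsilon>\<close> add up to
    \<open>3/4\<close>, below the available \<open>7/8\<close>.\<close>
  have side: "r \<bullet> w - \<kappa> * (r \<bullet> w) - \<kappa> * (X \<bullet> w) + P \<bullet> w + (norm w)\<^sup>2/2 - 7/8 * (norm w)\<^sup>2/\<epsilon>
      \<le> (8 + 6 * \<kappa>\<^sup>2) * \<sigma>"
    if "\<epsilon> * (norm r)\<^sup>2 \<le> 2 * \<sigma>" and X: "\<beta> * (norm X)\<^sup>2 \<le> 2 * \<sigma>" for r X w :: 'a
  proof -
    have "\<epsilon> * (norm X)\<^sup>2 \<le> \<beta> * (norm X)\<^sup>2" using \<epsilon>\<beta> by (intro mult_right_mono) auto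
    hence X': "\<epsilon> * (norm X)\<^sup>2 \<le> 2 * \<sigma>" using X by linarith
    have k: "\<kappa>\<^sup>2 * (\<epsilon> * (norm y)\<^sup>2) \<le> \<kappa>\<^sup>2 * (2 * \<sigma>)" if "\<epsilon> * (norm y)\<^sup>2 \<le> 2 * \<sigma>" for y :: 'a
      using that by (intro mult_left_mono) auto
    have 1: "r \<bullet> w \<le> 2 * (\<epsilon> * (norm r)\<^sup>2) + 1/8 * ((norm w)\<^sup>2/\<epsilon>)"
      using inner_le_weighted_squares[of "2*\<epsilon>" r w] \<epsilon> by simp
    have 2: "P \<bullet> w \<le> 2 * (\<epsilon> * (norm P)\<^sup>2) + 1/8 * ((norm w)\<^sup>2/\<epsilon>)"
      using inner_le_weighted_squares[of "2*\<epsilon>" P w] \<epsilon> by simp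
    have 3: "- \<kappa> * (r \<bullet> w) \<le> \<kappa>\<^sup>2 * (\<epsilon> * (norm r)\<^sup>2) + 1/4 * ((norm w)\<^sup>2/\<epsilon>)"
      using inner_le_weighted_squares[of "\<epsilon>" "(- \<kappa>) *\<^sub>R r" w] \<epsilon> by (simp add: power_mult_distrib mult_ac)
    have 4: "- \<kappa> * (X \<bullet> w) \<le> 2 * (\<kappa>\<^sup>2 * (\<epsilon> * (norm X)\<^sup>2)) + 1/8 * ((norm w)\<^sup>2/\<epsilon>)"
      using inner_le_weighted_squares[of "2*\<epsilon>" "(- \<kappa>) *\<^sub>R X" w] \<epsilon> by (simp add: power_mult_distrib mult_ac)
    have 5: "(norm w)\<^sup>2/2 \<le> 1/8 * ((norm w)\<^sup>2/\<epsilon>)"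
      using \<epsilon> mult_right_mono[of "4 * \<epsilon>" 1 "(norm w)\<^sup>2"] by (simp add: field_simps)
    have 6: "(norm w)\<^sup>2/\<epsilon> \<ge> 0" using \<epsilon> by simp
    show ?thesis using 1 2 3 4 5 6 P k[OF that(1)] k[OF X'] that(1)
      by (simp add: algebra_simps)
  qed
  have cross: "- \<kappa> * \<beta> * (Y \<bullet> B) \<le> \<bar>\<kappa>\<bar> * (2 * \<sigma>)" if Y: "\<beta> * (norm Y)\<^sup>2 \<le> 2 * \<sigma>" for Y
  proof -
    have "\<bar>Y \<bullet> B\<bar> \<le> norm Y * norm B" by (rule Cauchy_Schwarz_ineq2)
    also have "\<dots> \<le> ((norm Y)\<^sup>2 + (norm B)\<^sup>2) / 2"
      using sum_squares_bound[of "norm Y" "norm B"] by simp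
    finally have "\<beta> * \<bar>Y \<bullet> B\<bar> \<le> \<beta> * (((norm Y)\<^sup>2 + (norm B)\<^sup>2) / 2)" using \<beta> by simp
    hence "\<beta> * \<bar>Y \<bullet> B\<bar> \<le> 2 * \<sigma>" using Y chain(2) by (simp add: B_def algebra_simps)
    hence "\<bar>\<kappa>\<bar> * (\<beta> * \<bar>Y \<bullet> B\<bar>) \<le> \<bar>\<kappa>\<bar> * (2 * \<sigma>)" by (intro mult_left_mono) auto
    moreover have "- \<kappa> * \<beta> * (Y \<bullet> B) \<le> \<bar>- \<kappa> * \<beta> * (Y \<bullet> B)\<bar>" by (rule abs_ge_self)
    ultimately show ?thesis using \<beta> by (simp add: abs_mult mult.assoc)
  qed
  have G': "\<beta> * (norm (- G))\<^sup>2 \<le> 2 * \<sigma>" using chain(3) unfolding G_def norm_minus_cancel .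
  have main: "- 7/8 * (norm w)\<^sup>2 / \<epsilon> - 7/8 * (norm w')\<^sup>2 / \<epsilon> + \<rho> \<bullet> w + \<gamma> \<bullet> w'
      - \<beta> * \<kappa> * (\<pi> \<bullet> (\<pi> - \<rho>)) - \<beta> * \<kappa> * (\<mu> \<bullet> (\<mu> - \<gamma>))
      + \<beta>\<^sup>2/2 * (norm (\<pi> - \<rho>))\<^sup>2 - \<beta>\<^sup>2/2 * (norm (\<mu> - \<gamma>))\<^sup>2
    = (\<rho> \<bullet> w - \<kappa> * (\<rho> \<bullet> w) - \<kappa> * (A \<bullet> w) + P \<bullet> w + (norm w)\<^sup>2/2 - 7/8 * (norm w)\<^sup>2/\<epsilon>)
    + (\<gamma> \<bullet> w' - \<kappa> * (\<gamma> \<bullet> w') - \<kappa> * ((- G) \<bullet> w') + P \<bullet> w' + (norm w')\<^sup>2/2 - 7/8 * (norm w')\<^sup>2/\<epsilon>)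
    - (norm w')\<^sup>2
    - \<kappa> * \<beta> * (A \<bullet> B) - \<kappa> * \<beta> * (B \<bullet> B) - \<kappa> * \<beta> * (G \<bullet> B)"
  proof -
    have e: "\<beta> *\<^sub>R A = P + w" "\<beta> *\<^sub>R G = P - w'"
      by (simp_all add: w_def w'_def P_def A_def B_def G_def)
    have e1: "\<beta>\<^sup>2/2 * (norm (\<pi> - \<rho>))\<^sup>2 = (norm P)\<^sup>2/2 + P \<bullet> w + (norm w)\<^sup>2/2"
    proof -
      have "\<beta>\<^sup>2/2 * (norm (\<pi> - \<rho>))\<^sup>2 = (norm (\<beta> *\<^sub>R A))\<^sup>2/2" by (simp add: A_def power_mult_distrib)
      thus ?thesis unfolding e power2_norm_eq_inner by (simp add: inner_simps inner_commute)
    qed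
    have e2: "\<beta>\<^sup>2/2 * (norm (\<mu> - \<gamma>))\<^sup>2 = (norm P)\<^sup>2/2 - P \<bullet> w' + (norm w')\<^sup>2/2"
    proof -
      have "\<beta>\<^sup>2/2 * (norm (\<mu> - \<gamma>))\<^sup>2 = (norm (\<beta> *\<^sub>R G))\<^sup>2/2"
        by (simp add: G_def power_mult_distrib norm_minus_commute)
      thus ?thesis unfolding e power2_norm_eq_inner by (simp add: inner_simps inner_commute)
    qed
    have e3: "\<beta> * \<kappa> * (\<pi> \<bullet> (\<pi> - \<rho>)) = \<kappa> * ((\<rho> + A) \<bullet> (P + w))"
      unfolding e(1)[symmetric] by (simp add: A_def)
    have e4: "\<beta> * \<kappa> * (\<mu> \<bullet> (\<mu> - \<gamma>)) = - \<kappa> * ((\<gamma> - G) \<bullet> (P - w'))"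
      unfolding e(2)[symmetric] by (simp add: G_def inner_simps algebra_simps)
    have r: "\<rho> = \<gamma> + B" by (simp add: B_def)
    show ?thesis unfolding e1 e2 e3 e4 unfolding r
      by (simp add: inner_simps P_def inner_commute algebra_simps)
  qed
  show ?thesis
    unfolding main
    using side[OF size(1) chain(1)[folded A_def], of w] side[OF size(2) G', of w']
      cross[OF chain(1)[folded A_def]] cross[OF chain(2)[folded B_def]] cross[OF chain(3)[folded G_def]]
      zero_le_power2[of "norm w'"]
    unfolding distrib_right mult.assoc by linarith
qed

section \<open>The comparison principle\<close>

text \<open>A near-maximizer \<open>(\<pi>, \<rho>, \<gamma>, \<mu>)\<close> of
  \<open>w1 x + w2 y - \<beta> * chain_cost x \<rho> \<gamma> y - \<epsilon> * (energy_cost q \<rho> + energy_cost q \<gamma>)\<close> is considered.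
  The middle points have finite energy and serve as centers of the test functions for \<open>w1\<close> at \<open>\<pi>\<close> and
  \<open>w2\<close> at \<open>\<mu>\<close>. Adding the two inequalities, the energy differences are estimated by the slopes at \<open>\<rho>\<close>
  and \<open>\<gamma>\<close>, whose energy terms cancel, and the rest is small by the bound on the penalties. Finally
  \<open>\<pi>\<close> and \<open>\<mu>\<close> are close, so uniform continuity lets \<open>h1\<close> be evaluated at \<open>\<mu>\<close>.\<close>

lemma quadratic_test_comparison:
  fixes q :: "'a::real_inner \<Rightarrow> real"
  assumes q: "convex_on D q" "\<And>x. x \<in> D \<Longrightarrow> 0 \<le> q x" and dense: "closure D = UNIV" and lam: "lam > 0"
    and w1: "quadratic_test_subsolution lam \<kappa> q D 1 h1 w1" "bounded (range w1)"
    and w2: "quadratic_test_subsolution lam \<kappa> q D (-1) h2 w2" "bounded (range w2)"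
    and h1: "uniformly_continuous_on UNIV h1"
    and K: "\<And>x. h1 x + h2 x \<le> K"
  shows "w1 x0 + w2 x0 \<le> K"
proof (rule field_le_epsilon)
  fix e :: real assume e: "e > 0"
  obtain M1 M2 where M: "\<And>y. \<bar>w1 y\<bar> \<le> M1" "\<And>y. \<bar>w2 y\<bar> \<le> M2"
    using bounded_range_abs_le[OF w1(2)] bounded_range_abs_le[OF w2(2)] by metis
  define \<Psi> where "\<Psi> \<beta> \<epsilon> x \<rho> \<gamma> y = w1 x + w2 y - \<beta> * chain_cost x \<rho> \<gamma> y - \<epsilon> * (energy_cost q \<rho> + energy_cost q \<gamma>)"
    for \<beta> \<epsilon> x \<rho> \<gamma> y
  define J :: "('a \<times> 'a \<times> 'a \<times> 'a) set" where "J = {(x, \<rho>, \<gamma>, y). \<rho> \<in> D \<and> \<gamma> \<in> D}"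
  define S where "S \<beta> \<epsilon> = (SUP (x, \<rho>, \<gamma>, y)\<in>J. \<Psi> \<beta> \<epsilon> x \<rho> \<gamma> y)" for \<beta> \<epsilon>
  obtain d0 where d0: "d0 \<in> D" using dense by fastforce
  have J_ne: "J \<noteq> {}" using d0 by (auto simp: J_def)
  have chain0: "0 \<le> chain_cost x \<rho> \<gamma> y" for x \<rho> \<gamma> y :: 'a by (simp add: chain_cost_def)
  have energy0: "0 \<le> energy_cost q \<rho>" if "\<rho> \<in> D" for \<rho> using q(2)[OF that] by (simp add: energy_cost_def)
  have \<Psi>anti: "\<Psi> \<beta>' \<epsilon>' x \<rho> \<gamma> y \<le> \<Psi> \<beta> \<epsilon> x \<rho> \<gamma> y"
    if "\<beta> \<le> \<beta>'" "\<epsilon> \<le> \<epsilon>'" "\<rho> \<in> D" "\<gamma> \<in> D" for \<beta> \<beta>' \<epsilon> \<epsilon>' x \<rho> \<gamma> y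
    unfolding \<Psi>_def using that chain0 energy0 by (intro diff_mono mult_right_mono add_nonneg_nonneg) auto
  have \<Psi>ub: "\<Psi> \<beta> \<epsilon> x \<rho> \<gamma> y \<le> M1 + M2" if "0 < \<beta>" "0 < \<epsilon>" "\<rho> \<in> D" "\<gamma> \<in> D" for \<beta> \<epsilon> x \<rho> \<gamma> y
  proof -
    have "\<Psi> \<beta> \<epsilon> x \<rho> \<gamma> y \<le> \<Psi> 0 0 x \<rho> \<gamma> y" using that by (intro \<Psi>anti) auto
    also have "\<dots> \<le> M1 + M2" using M(1)[of x] M(2)[of y] by (simp add: \<Psi>_def)
    finally show ?thesis .
  qed
  have bdd: "bdd_above ((\<lambda>(x, \<rho>, \<gamma>, y). \<Psi> \<beta> \<epsilon> x \<rho> \<gamma> y) ` J)" if "0 < \<beta>" "0 < \<epsilon>" for \<beta> \<epsilon>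
    using \<Psi>ub[OF that] by (intro bdd_aboveI2[where M = "M1 + M2"]) (auto simp: J_def)
  have \<Psi>S: "\<Psi> \<beta> \<epsilon> x \<rho> \<gamma> y \<le> S \<beta> \<epsilon>" if "0 < \<beta>" "0 < \<epsilon>" "\<rho> \<in> D" "\<gamma> \<in> D" for \<beta> \<epsilon> x \<rho> \<gamma> y
    unfolding S_def using cSUP_upper[OF _ bdd[OF that(1,2)], of "(x, \<rho>, \<gamma>, y)"] that by (simp add: J_def)

  obtain \<delta> where \<delta>: "\<delta> > 0" "\<And>x y. dist x y < \<delta> \<Longrightarrow> dist (h1 x) (h1 y) < e/2"
    using h1 e unfolding uniformly_continuous_on_def by (metis UNIV_I half_gt_zero)
  define c where "c = 16 + 12 * \<kappa>\<^sup>2 + 6 * \<bar>\<kappa>\<bar>"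
  have c: "c \<ge> 0" by (simp add: c_def)
  \<comment> \<open>\<open>c\<close> is the constant of the lemma \<open>hamiltonian_gap\<close>, used with the penalty bound \<open>4 * \<zeta>\<close>;
    \<open>\<zeta>\<close> is small enough that \<open>Z\<close> copies of it, the total error, cost at most \<open>e/2\<close>, and that the
    two outer points end up within distance \<open>\<delta>\<close>.\<close>
  define Z where "Z = 4 + lam * (4 * c + 1)"
  have Z: "Z \<ge> 4" using c lam by (simp add: Z_def)
  define \<zeta> where "\<zeta> = min (e / (2 * Z)) (\<delta>\<^sup>2 / 100)"
  have \<zeta>: "\<zeta> > 0" "Z * \<zeta> \<le> e / 2" "100 * \<zeta> \<le> \<delta>\<^sup>2"
    using e Z \<delta>(1) by (auto simp: \<zeta>_def min_def field_simps)
  obtain \<beta> \<epsilon> where \<beta>: "\<beta> \<ge> 1" and \<epsilon>: "0 < \<epsilon>" "\<epsilon> \<le> 1/4" "\<epsilon> * \<beta> \<le> 1"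
    and S: "w1 x0 + w2 x0 - \<zeta> \<le> S \<beta> \<epsilon>" "S (\<beta>/2) (\<epsilon>/2) \<le> S \<beta> \<epsilon> + \<zeta>"
  proof (rule doubling_parameters[of S "M1 + M2" "w1 x0 + w2 x0" \<zeta>])
    fix \<beta> \<beta>' \<epsilon> \<epsilon>' :: real assume *: "0 < \<beta>" "\<beta> \<le> \<beta>'" "0 < \<epsilon>" "\<epsilon> \<le> \<epsilon>'"
    show "S \<beta>' \<epsilon>' \<le> S \<beta> \<epsilon>"
      unfolding S_def[of \<beta>' \<epsilon>']
      by (rule cSUP_least[OF J_ne]) (use * in \<open>auto simp: J_def intro!: order_trans[OF \<Psi>anti \<Psi>S]\<close>)
  next
    fix \<beta> \<epsilon> :: real assume *: "0 < \<beta>" "0 < \<epsilon>"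
    show "S \<beta> \<epsilon> \<le> M1 + M2"
      unfolding S_def by (rule cSUP_least[OF J_ne]) (use \<Psi>ub * in \<open>auto simp: J_def\<close>)
  next
    fix \<beta> z :: real assume \<beta>: "0 < \<beta>" and z: "0 < z"
    \<comment> \<open>Move the middle points from \<open>x0\<close> to a nearby \<open>\<rho>\<close> of finite energy, then make \<open>\<epsilon>\<close> small.\<close>
    have "x0 \<in> closure D" using dense by simp
    moreover have "sqrt (z / (2 * \<beta>)) > 0" using \<beta> z by simp
    ultimately obtain \<rho> where \<rho>: "\<rho> \<in> D" "dist \<rho> x0 < sqrt (z / (2 * \<beta>))"
      by (meson closure_approachable)
    have "(norm (\<rho> - x0))\<^sup>2 \<le> (sqrt (z / (2 * \<beta>)))\<^sup>2" using \<rho>(2) by (intro power_mono) (auto simp: dist_norm)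
    hence d: "\<beta> * (norm (\<rho> - x0))\<^sup>2 \<le> z / 2" using \<beta> z by (simp add: field_simps)
    define t where "t = z / (2 * (2 * energy_cost q \<rho> + 1))"
    have en: "energy_cost q \<rho> \<ge> 0" using energy0 \<rho> by simp
    have t: "t > 0" using z en by (simp add: t_def)
    have te: "t * (2 * energy_cost q \<rho>) \<le> z / 2"
      using z en by (simp add: t_def field_simps)
    have "w1 x0 + w2 x0 - z \<le> \<Psi> \<beta> t x0 \<rho> \<rho> x0"
      using d te by (simp add: \<Psi>_def chain_cost_def norm_minus_commute algebra_simps)
    also have "\<dots> \<le> S \<beta> t" using \<beta> t \<rho> by (intro \<Psi>S)
    finally show "\<exists>\<epsilon>>0. w1 x0 + w2 x0 - z \<le> S \<beta> \<epsilon>" using t by blast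
  qed (use \<zeta> in auto)
  \<comment> \<open>The accuracy \<open>\<eta>\<close> of the maximization is chosen after \<open>\<beta>\<close> and \<open>\<epsilon>\<close>, to compensate the factor
    \<open>(\<beta> + 1) / \<epsilon>\<close> in the slope bound.\<close>
  define \<eta> where "\<eta> = min \<zeta> (\<zeta> * \<epsilon> / (16 * (\<beta> + 1)))"
  have "\<eta> \<le> \<zeta> * \<epsilon> / (16 * (\<beta> + 1))" by (simp add: \<eta>_def)
  hence "\<eta> * (16 * (\<beta> + 1)) \<le> \<zeta> * \<epsilon>" using \<beta> by (subst (asm) pos_le_divide_eq) auto
  hence \<eta>: "\<eta> > 0" "\<eta> \<le> \<zeta>" "16 * (\<beta> + 1) * \<eta> / \<epsilon> \<le> \<zeta>"
    using \<zeta>(1) \<beta> \<epsilon>(1) by (auto simp: \<eta>_def pos_divide_le_eq mult.commute)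
  have "\<exists>i\<in>J. S \<beta> \<epsilon> - \<eta>/3 < (\<lambda>(x, \<rho>, \<gamma>, y). \<Psi> \<beta> \<epsilon> x \<rho> \<gamma> y) i"
    using \<beta> \<epsilon> \<eta> unfolding S_def by (subst less_cSUP_iff[symmetric]) (auto intro!: bdd J_ne)
  then obtain x \<rho> \<gamma> y where *: "\<rho> \<in> D" "\<gamma> \<in> D" "S \<beta> \<epsilon> - \<eta>/3 < \<Psi> \<beta> \<epsilon> x \<rho> \<gamma> y"
    by (auto simp: J_def)
  \<comment> \<open>Replacing the outer points by viscosity test points keeps the quadruple a near-maximizer.\<close>
  have "\<beta> > 0" "\<eta>/3 > 0" using \<beta> \<eta> by auto
  then obtain \<pi> where \<pi>: "\<pi> \<in> D" "w1 x - \<beta>/2 * (norm (x - \<rho>))\<^sup>2 \<le> w1 \<pi> - \<beta>/2 * (norm (\<pi> - \<rho>))\<^sup>2 + \<eta>/3"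
      "w1 \<pi> - h1 \<pi> \<le> lam * (\<beta> * (q \<rho> - q \<pi>) - \<beta> * \<kappa> * (\<pi> \<bullet> (\<pi> - \<rho>)) + 1 * (\<beta>\<^sup>2/2 * (norm (\<pi> - \<rho>))\<^sup>2)) + \<eta>/3"
    using w1(1) *(1) unfolding quadratic_test_subsolution_def by blast
  obtain \<mu> where \<mu>: "\<mu> \<in> D" "w2 y - \<beta>/2 * (norm (y - \<gamma>))\<^sup>2 \<le> w2 \<mu> - \<beta>/2 * (norm (\<mu> - \<gamma>))\<^sup>2 + \<eta>/3"
      "w2 \<mu> - h2 \<mu> \<le> lam * (\<beta> * (q \<gamma> - q \<mu>) - \<beta> * \<kappa> * (\<mu> \<bullet> (\<mu> - \<gamma>)) + -1 * (\<beta>\<^sup>2/2 * (norm (\<mu> - \<gamma>))\<^sup>2)) + \<eta>/3"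
    using w2(1) *(2) \<open>\<beta> > 0\<close> \<open>\<eta>/3 > 0\<close> unfolding quadratic_test_subsolution_def by blast
  have near: "S \<beta> \<epsilon> - \<eta> \<le> \<Psi> \<beta> \<epsilon> \<pi> \<rho> \<gamma> \<mu>"
    using *(3) \<pi>(2) \<mu>(2)
    by (simp add: \<Psi>_def chain_cost_def norm_minus_commute[of \<gamma> y] norm_minus_commute[of \<gamma> \<mu>]
        algebra_simps add_divide_distrib)

  \<comment> \<open>Halving both parameters removes half of the penalty but raises the supremum by at most \<open>\<zeta>\<close>.\<close>
  have pen: "\<beta> * chain_cost \<pi> \<rho> \<gamma> \<mu> + \<epsilon> * (energy_cost q \<rho> + energy_cost q \<gamma>) \<le> 4 * \<zeta>"
  proof -
    have "\<Psi> (\<beta>/2) (\<epsilon>/2) \<pi> \<rho> \<gamma> \<mu> \<le> S (\<beta>/2) (\<epsilon>/2)" using \<beta> \<epsilon> * by (intro \<Psi>S) auto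
    moreover have "2 * \<Psi> (\<beta>/2) (\<epsilon>/2) \<pi> \<rho> \<gamma> \<mu> = 2 * \<Psi> \<beta> \<epsilon> \<pi> \<rho> \<gamma> \<mu>
        + (\<beta> * chain_cost \<pi> \<rho> \<gamma> \<mu> + \<epsilon> * (energy_cost q \<rho> + energy_cost q \<gamma>))"
      by (simp add: \<Psi>_def field_simps)
    ultimately have "2 * \<Psi> \<beta> \<epsilon> \<pi> \<rho> \<gamma> \<mu>
        + (\<beta> * chain_cost \<pi> \<rho> \<gamma> \<mu> + \<epsilon> * (energy_cost q \<rho> + energy_cost q \<gamma>))
        \<le> 2 * \<Psi> \<beta> \<epsilon> \<pi> \<rho> \<gamma> \<mu> + 4 * \<zeta>"
      using S(2) near \<eta>(2) by linarith
    thus ?thesis by simp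
  qed
  have e0: "0 \<le> \<epsilon> * (energy_cost q \<rho>)" "0 \<le> \<epsilon> * (energy_cost q \<gamma>)"
    using energy0 * \<epsilon> by auto
  have c3: "\<beta> * (norm (\<pi> - \<rho>))\<^sup>2 + \<beta> * (norm (\<rho> - \<gamma>))\<^sup>2 + \<beta> * (norm (\<gamma> - \<mu>))\<^sup>2 \<le> 2 * (4 * \<zeta>)"
    using pen e0 by (simp add: chain_cost_def algebra_simps add_divide_distrib)
  have n0: "0 \<le> \<beta> * (norm z)\<^sup>2" for z :: 'a using \<beta> by simp
  have chain: "\<beta> * (norm (\<pi> - \<rho>))\<^sup>2 \<le> 2 * (4 * \<zeta>)" "\<beta> * (norm (\<rho> - \<gamma>))\<^sup>2 \<le> 2 * (4 * \<zeta>)"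
      "\<beta> * (norm (\<gamma> - \<mu>))\<^sup>2 \<le> 2 * (4 * \<zeta>)"
    using c3 n0[of "\<pi> - \<rho>"] n0[of "\<rho> - \<gamma>"] n0[of "\<gamma> - \<mu>"] by linarith+
  have size: "\<epsilon> * (norm z)\<^sup>2 \<le> 2 * (4 * \<zeta>)" if "z \<in> D" "\<epsilon> * energy_cost q z \<le> 4 * \<zeta>" for z
  proof -
    have "\<epsilon> * ((norm z)\<^sup>2 / 2) \<le> \<epsilon> * energy_cost q z"
      using q(2)[OF that(1)] \<epsilon> by (intro mult_left_mono) (auto simp: energy_cost_def)
    thus ?thesis using that(2) by linarith
  qed
  have bc: "0 \<le> \<beta> * chain_cost \<pi> \<rho> \<gamma> \<mu>" using \<beta> chain0 by simp
  have "\<epsilon> * energy_cost q \<rho> \<le> 4 * \<zeta>" "\<epsilon> * energy_cost q \<gamma> \<le> 4 * \<zeta>"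
    using pen[unfolded distrib_left] e0 bc by linarith+
  hence size': "\<epsilon> * (norm \<rho>)\<^sup>2 \<le> 2 * (4 * \<zeta>)" "\<epsilon> * (norm \<gamma>)\<^sup>2 \<le> 2 * (4 * \<zeta>)"
    using * by (auto intro!: size simp only:)

  have slope1: "\<beta> * (q \<rho> - q \<pi>) \<le> \<beta> * (q \<gamma> - q \<rho>)
      - 7/8 * (norm (\<beta> *\<^sub>R (\<pi> - \<rho>) - \<beta> *\<^sub>R (\<rho> - \<gamma>)))\<^sup>2 / \<epsilon>
      + \<rho> \<bullet> (\<beta> *\<^sub>R (\<pi> - \<rho>) - \<beta> *\<^sub>R (\<rho> - \<gamma>)) + 8 * (\<beta> + 1) * \<eta> / \<epsilon>"
  proof (rule energy_slope_at_near_maximizer[OF q(1) \<open>\<beta> > 0\<close> \<epsilon>(1) _ *(1) \<pi>(1) *(2)])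
    fix \<rho>' assume "\<rho>' \<in> D"
    hence "\<Psi> \<beta> \<epsilon> \<pi> \<rho>' \<gamma> \<mu> \<le> \<Psi> \<beta> \<epsilon> \<pi> \<rho> \<gamma> \<mu> + \<eta>"
      using \<Psi>S[of \<beta> \<epsilon> \<rho>' \<gamma> \<pi> \<mu>] near * \<open>\<beta> > 0\<close> \<epsilon> by linarith
    thus "- \<beta>/2 * ((norm (\<pi> - \<rho>'))\<^sup>2 + (norm (\<rho>' - \<gamma>))\<^sup>2) - \<epsilon> * energy_cost q \<rho>'
      \<le> - \<beta>/2 * ((norm (\<pi> - \<rho>))\<^sup>2 + (norm (\<rho> - \<gamma>))\<^sup>2) - \<epsilon> * energy_cost q \<rho> + \<eta>"
      by (simp add: \<Psi>_def chain_cost_def field_simps)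
  qed (use \<epsilon> in auto)
  have slope2: "\<beta> * (q \<gamma> - q \<mu>) \<le> \<beta> * (q \<rho> - q \<gamma>)
      - 7/8 * (norm (\<beta> *\<^sub>R (\<mu> - \<gamma>) - \<beta> *\<^sub>R (\<gamma> - \<rho>)))\<^sup>2 / \<epsilon>
      + \<gamma> \<bullet> (\<beta> *\<^sub>R (\<mu> - \<gamma>) - \<beta> *\<^sub>R (\<gamma> - \<rho>)) + 8 * (\<beta> + 1) * \<eta> / \<epsilon>"
  proof (rule energy_slope_at_near_maximizer[OF q(1) \<open>\<beta> > 0\<close> \<epsilon>(1) _ *(2) \<mu>(1) *(1)])
    fix \<gamma>' assume "\<gamma>' \<in> D"
    hence "\<Psi> \<beta> \<epsilon> \<pi> \<rho> \<gamma>' \<mu> \<le> \<Psi> \<beta> \<epsilon> \<pi> \<rho> \<gamma> \<mu> + \<eta>"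
      using \<Psi>S[of \<beta> \<epsilon> \<rho> \<gamma>' \<pi> \<mu>] near * \<open>\<beta> > 0\<close> \<epsilon> by linarith
    thus "- \<beta>/2 * ((norm (\<mu> - \<gamma>'))\<^sup>2 + (norm (\<gamma>' - \<rho>))\<^sup>2) - \<epsilon> * energy_cost q \<gamma>'
      \<le> - \<beta>/2 * ((norm (\<mu> - \<gamma>))\<^sup>2 + (norm (\<gamma> - \<rho>))\<^sup>2) - \<epsilon> * energy_cost q \<gamma> + \<eta>"
      by (simp add: \<Psi>_def chain_cost_def norm_minus_commute[of \<mu> \<gamma>'] norm_minus_commute[of \<gamma>' \<rho>] norm_minus_commute[of \<mu> \<gamma>] norm_minus_commute[of \<gamma> \<rho>] field_simps)
  qed (use \<epsilon> in auto)
  have flip: "\<beta> *\<^sub>R (\<mu> - \<gamma>) - \<beta> *\<^sub>R (\<gamma> - \<rho>) = \<beta> *\<^sub>R (\<rho> - \<gamma>) - \<beta> *\<^sub>R (\<gamma> - \<mu>)"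
    by (simp add: algebra_simps)
  note gap = hamiltonian_gap[OF \<beta> \<epsilon> chain size', of \<kappa>, folded c_def]
  have ham: "(\<beta> * (q \<rho> - q \<pi>) - \<beta> * \<kappa> * (\<pi> \<bullet> (\<pi> - \<rho>)) + 1 * (\<beta>\<^sup>2/2 * (norm (\<pi> - \<rho>))\<^sup>2))
      + (\<beta> * (q \<gamma> - q \<mu>) - \<beta> * \<kappa> * (\<mu> \<bullet> (\<mu> - \<gamma>)) + -1 * (\<beta>\<^sup>2/2 * (norm (\<mu> - \<gamma>))\<^sup>2)) \<le> (4 * c + 1) * \<zeta>"
  proof -
    have "\<beta> * (q \<gamma> - q \<rho>) + \<beta> * (q \<rho> - q \<gamma>) = 0" by (simp add: algebra_simps)
    moreover have "8 * (\<beta> + 1) * \<eta> / \<epsilon> + 8 * (\<beta> + 1) * \<eta> / \<epsilon> \<le> \<zeta>"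
      using \<eta>(3) by (simp add: algebra_simps add_divide_distrib)
    moreover have "(4 * c + 1) * \<zeta> = c * (4 * \<zeta>) + \<zeta>" by (simp add: algebra_simps)
    ultimately show ?thesis using slope1 slope2[unfolded flip] gap by linarith
  qed
  have "(w1 \<pi> - h1 \<pi>) + (w2 \<mu> - h2 \<mu>) \<le> lam * ((4 * c + 1) * \<zeta>) + 2 * (\<eta>/3)"
    using \<pi>(3) \<mu>(3) mult_left_mono[OF ham, of lam] lam by (simp add: distrib_left)
  moreover have "h1 \<pi> + h2 \<mu> \<le> K + e/2"
  proof -
    have sq: "(norm z)\<^sup>2 \<le> (3/10 * \<delta>)\<^sup>2" if "\<beta> * (norm z)\<^sup>2 \<le> 2 * (4 * \<zeta>)" for z :: 'a
    proof -
      have "1 * (norm z)\<^sup>2 \<le> \<beta> * (norm z)\<^sup>2" using \<beta> by (intro mult_right_mono) auto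
      thus ?thesis using that \<zeta>(1,3) by (simp add: power_mult_distrib power_divide)
    qed
    have d: "norm z \<le> 3/10 * \<delta>" if "\<beta> * (norm z)\<^sup>2 \<le> 2 * (4 * \<zeta>)" for z :: 'a
      using power2_le_imp_le[OF sq[OF that]] \<delta>(1) by simp
    have "\<pi> - \<mu> = (\<pi> - \<rho>) + (\<rho> - \<gamma>) + (\<gamma> - \<mu>)" by simp
    hence "norm (\<pi> - \<mu>) \<le> norm (\<pi> - \<rho>) + norm (\<rho> - \<gamma>) + norm (\<gamma> - \<mu>)"
      by (metis norm_triangle_mono norm_triangle_ineq order_refl)
    hence "dist \<pi> \<mu> < \<delta>" using d[OF chain(1)] d[OF chain(2)] d[OF chain(3)] \<delta>(1) by (simp add: dist_norm)
    hence "\<bar>h1 \<pi> - h1 \<mu>\<bar> < e/2" using \<delta>(2) by (simp add: dist_real_def)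
    thus ?thesis using K[of \<mu>] by linarith
  qed
  moreover have "w1 x0 + w2 x0 \<le> w1 \<pi> + w2 \<mu> + 2 * \<zeta>"
  proof -
    have "\<Psi> \<beta> \<epsilon> \<pi> \<rho> \<gamma> \<mu> \<le> \<Psi> 0 0 \<pi> \<rho> \<gamma> \<mu>" using \<beta> \<epsilon> * by (intro \<Psi>anti) auto
    thus ?thesis using near S(1) \<eta>(2) by (simp add: \<Psi>_def)
  qed
  moreover have "Z * \<zeta> = lam * ((4 * c + 1) * \<zeta>) + 4 * \<zeta>" by (simp add: Z_def algebra_simps)
  ultimately show "w1 x0 + w2 x0 \<le> K + e" using \<zeta>(1,2) \<eta>(1,2) by linarith
qed

theorem proposition5p8:
  fixes C :: "('a::{real_inner, complete_space} \<times> 'a) set"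
    and \<kappa> lam :: real
    and \<E> :: "'a \<Rightarrow> ereal"
    and h\<^sub>1 h\<^sub>2 u v :: "'a \<Rightarrow> real"
  assumes "single_valued C" and "subspace C"
    and "self_adjoint_operator C" and "maximally_dissipative C"
    and "\<E> = lsc_regularization (quadratic_energy C \<kappa>)"
    and "lam > 0"
    and "bounded (range h\<^sub>1)" and "uniformly_continuous_on UNIV h\<^sub>1"
    and "bounded (range h\<^sub>2)" and "uniformly_continuous_on UNIV h\<^sub>2"
    and "viscosity_subsolution lam (H_dagger \<kappa> \<E>) h\<^sub>1 u"
    and "viscosity_supersolution lam (H_ddagger \<kappa> \<E>) h\<^sub>2 v"
  shows "(SUP \<pi>. ereal (u \<pi> - v \<pi>)) \<le> (SUP \<pi>. ereal (h\<^sub>1 \<pi> - h\<^sub>2 \<pi>))"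
proof (rule ereal_le_real)
  fix K assume K: "(SUP \<pi>. ereal (h\<^sub>1 \<pi> - h\<^sub>2 \<pi>)) \<le> ereal K"
  interpret dissipative_quadratic_energy C \<kappa> \<E>
    by unfold_locales (use assms in \<open>auto simp: maximally_dissipative_def\<close>)
  have dense: "closure {x. \<E> x < \<infinity>} = UNIV"
    using closure_mono[of "Domain C" "{x. \<E> x < \<infinity>}"] dense_Domain_self_adjoint[OF assms(1-3)]
      energy_finite_on_Domain by auto
  have "u x + - v x \<le> K" for x
  proof (rule quadratic_test_comparison[OF convex_on_convex_part _ dense \<open>lam > 0\<close>
        subsolution_imp_quadratic_test[OF \<open>lam > 0\<close> assms(11)] _
        supersolution_imp_quadratic_test[OF \<open>lam > 0\<close> assms(12)] _ assms(8)])
    show "bounded (range u)" "bounded (range (\<lambda>x. - v x))"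
      using assms(11,12) by (auto simp: viscosity_subsolution_def viscosity_supersolution_def bounded_iff)
    show "h\<^sub>1 x + - h\<^sub>2 x \<le> K" for x
      using order_trans[OF SUP_upper K, of x] by simp
  qed (use convex_part_nonneg in auto)
  thus "(SUP \<pi>. ereal (u \<pi> - v \<pi>)) \<le> ereal K" by (intro SUP_least) simp
qed

end
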